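(* Let $A$ be a real symmetric $3\times 3$ matrix of full rank, and let $X_A\subset\mathbb{P}^4$ be the image of the Veronese surface $\nu_2(\mathbb{P}^2)\subset\mathbb{P}^5$ under the linear projection $\pi_A:\mathbb{P}^5\dashrightarrow\mathbb{P}^4$ with center the point $A\in\mathbb{P}^5$. Then: (i) if $A$ has signature $(3,0)$ (up to a global sign), then $\operatorname{conv} X_A=\mathbb{R}^4$; (ii) if $A$ has signature $(2,1)$ (up to a global sign), then, in an affine chart $\mathbb{R}^4\subset\mathbb{P}^4(\mathbb{R})$ in which the real locus of $X_A$ is compact, the algebraic boundary $\partial_a(\operatorname{conv} X_A)\subset\mathbb{P}^4$ is a hypersurface of degree $6$.
   Context: $\mathbb{P}^5$ is identified with the projective space of symmetric $3\times 3$ matrices, and the Veronese surface $\nu_2(\mathbb{P}^2)$ with the set of rank-one matrices $tt^T$, $t\in\mathbb{P}^2$. The signature $(p,n)$ of $A$ records the number $p$ of positive and the number $n$ of negative eigenvalues. For a real projective variety $X\subset\mathbb{P}^4$ and an affine chart $\mathbb{R}^4\subset\mathbb{P}^4(\mathbb{R})$ (the complement of a real hyperplane), $\operatorname{conv}X\subset\mathbb{R}^4$ denotes the convex hull of the real points of $X$ lying in that chart. The algebraic boundary $\partial_a(\operatorname{conv}X)\subset\mathbb{P}^4$ is the Zariski closure in $\mathbb{P}^4$ of the topological (Euclidean) boundary of $\operatorname{conv}X$. *)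

theory Defs
  imports
    "HOL-Analysis.Analysis"
    "HOL-Library.Poly_Mapping"
    "HOL-Computational_Algebra.Squarefree"
begin

section \<open>Signature of a real symmetric matrix\<close>

definition eigenspace :: "real^'n^'n \<Rightarrow> real \<Rightarrow> (real^'n) set" where
  "eigenspace A l = {v. A *v v = l *\<^sub>R v}"

definition eigenvalue :: "real^'n^'n \<Rightarrow> real \<Rightarrow> bool" where
  "eigenvalue A l \<longleftrightarrow> (\<exists>v. v \<noteq> 0 \<and> A *v v = l *\<^sub>R v)"

text \<open>Eigenvalues are counted with multiplicity. Only symmetric matrices are considered, so the
  algebraic multiplicity of an eigenvalue is the dimension of its eigenspace.\<close>

definition signature :: "real^'n^'n \<Rightarrow> nat \<times> nat" where
  "signature A =
     (\<Sum>l\<in>{l. l > 0 \<and> eigenvalue A l}. dim (eigenspace A l),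
      \<Sum>l\<in>{l. l < 0 \<and> eigenvalue A l}. dim (eigenspace A l))"


section \<open>Complex projective space and its Zariski topology\<close>

text \<open>A point of complex projective space is a one-dimensional subspace of \<open>complex^'n\<close>;
  \<open>pt v\<close>, for \<open>v \<noteq> 0\<close>, is the point with homogeneous coordinates \<open>v\<close>.\<close>

definition pt :: "complex^'n \<Rightarrow> (complex^'n) set" where
  "pt v = range (\<lambda>c. c *s v)"

text \<open>Polynomials in the variables indexed by the finite type \<open>'n\<close>: a monomial is its exponent
  vector, and a polynomial maps monomials to coefficients.\<close>

type_synonym 'n mpoly = "('n \<Rightarrow>\<^sub>0 nat) \<Rightarrow>\<^sub>0 complex"

definition mpoly_eval :: "('n::finite) mpoly \<Rightarrow> complex^'n \<Rightarrow> complex" where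
  "mpoly_eval p v =
     (\<Sum>m\<in>Poly_Mapping.keys p.
        Poly_Mapping.lookup p m * (\<Prod>i\<in>UNIV. (v $ i) ^ Poly_Mapping.lookup m i))"

text \<open>The zero polynomial is homogeneous of every degree.\<close>

definition homogeneous :: "nat \<Rightarrow> ('n::finite) mpoly \<Rightarrow> bool" where
  "homogeneous d p \<longleftrightarrow>
     (\<forall>m\<in>Poly_Mapping.keys p. (\<Sum>i\<in>UNIV. Poly_Mapping.lookup m i) = d)"

definition zero_locus :: "('n::finite) mpoly \<Rightarrow> (complex^'n) set set" where
  "zero_locus p = {pt v |v. v \<noteq> 0 \<and> mpoly_eval p v = 0}"

definition zariski_closure :: "(complex^'n::finite) set set \<Rightarrow> (complex^'n) set set" where
  "zariski_closure S = \<Inter>{zero_locus p |p. (\<exists>d. homogeneous d p) \<and> S \<subseteq> zero_locus p}"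

text \<open>The degree of a hypersurface is that of a squarefree equation for it.\<close>

definition hypersurface_of_degree :: "nat \<Rightarrow> (complex^'n::finite) set set \<Rightarrow> bool" where
  "hypersurface_of_degree d V \<longleftrightarrow>
     0 < d \<and> (\<exists>f. homogeneous d f \<and> squarefree f \<and> V = zero_locus f)"


section \<open>The projected Veronese surface\<close>

text \<open>A linear projection \<open>\<pi>\<close> from projective 5-space, the space of symmetric \<open>3 \<times> 3\<close> matrices,
  onto projective 4-space with center the point \<open>A\<close>. It is determined by \<open>A\<close> up to a linear change
  of coordinates on the target, and its values on non-symmetric matrices are irrelevant.\<close>

definition projection_from :: "real^3^3 \<Rightarrow> (real^3^3 \<Rightarrow> real^5) \<Rightarrow> bool" where
  "projection_from A \<pi> \<longleftrightarrow>
     linear \<pi> \<and> \<pi> ` {M. transpose M = M} = UNIV \<and>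
     {M. transpose M = M \<and> \<pi> M = 0} = span {A}"

definition complexify :: "(real^3^3 \<Rightarrow> real^5) \<Rightarrow> complex^3^3 \<Rightarrow> complex^5" where
  "complexify \<pi> M =
     (\<chi> k. Complex (\<pi> (\<chi> i j. Re (M $ i $ j)) $ k) (\<pi> (\<chi> i j. Im (M $ i $ j)) $ k))"

definition veronese :: "complex^3 \<Rightarrow> complex^3^3" where
  "veronese t = (\<chi> i j. t $ i * t $ j)"

text \<open>If the center is a matrix of full rank, it does not lie on the Veronese surface, so
  \<open>complexify \<pi> (veronese t) \<noteq> 0\<close> for \<open>t \<noteq> 0\<close>.\<close>

definition projected_veronese :: "(real^3^3 \<Rightarrow> real^5) \<Rightarrow> (complex^5) set set" where
  "projected_veronese \<pi> = {pt (complexify \<pi> (veronese t)) |t. t \<noteq> 0}"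


section \<open>Affine charts, convex hulls and algebraic boundaries\<close>

definition real_pt :: "real^'n \<Rightarrow> (complex^'n) set" where
  "real_pt y = pt (\<chi> k. complex_of_real (y $ k))"

text \<open>For \<open>l \<noteq> 0\<close>, the complement of the real hyperplane \<open>l \<bullet> y = 0\<close> in real projective space is
  identified with the affine space \<open>l \<bullet> y = 1\<close>: each real point off the hyperplane has exactly one
  representative there. In projective 4-space this is an affine space of dimension 4.\<close>

definition chart :: "real^'n \<Rightarrow> (real^'n) set" where
  "chart l = {y. l \<bullet> y = 1}"

definition real_points_in_chart :: "real^'n \<Rightarrow> (complex^'n) set set \<Rightarrow> (real^'n) set" where
  "real_points_in_chart l X = {y \<in> chart l. real_pt y \<in> X}"

definition conv_in_chart :: "real^'n \<Rightarrow> (complex^'n) set set \<Rightarrow> (real^'n) set" where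
  "conv_in_chart l X = convex hull (real_points_in_chart l X)"

text \<open>The topological boundary is taken inside the chart, not inside \<open>real^'n\<close>.\<close>

definition algebraic_boundary ::
    "real^'n::finite \<Rightarrow> (complex^'n) set set \<Rightarrow> (complex^'n) set set" where
  "algebraic_boundary l X =
     zariski_closure (real_pt ` ((top_of_set (chart l)) frontier_of (conv_in_chart l X)))"

end

(* Write t = s0 k0 + s1 k1 + s2 k2 in a basis in which a center A of signature (2,1) is proportional to
   2 k1 k1^T - k0 k2^T - k2 k0^T.  Modulo A, the matrix t t^T depends only on the binary quartic
   (s0 + s1 x + s2 x^2)^2, so X_A becomes the variety of squares of binary quadratics in the P^4 of
   binary quartics.  The real locus is compact in a chart l = 1 exactly when l is definite on
   squares, and then conv X_A consists of the nonnegative quartics with l = 1.  Its boundary is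
   Zariski dense in the quartics with a double root, the zero locus of the discriminant, which
   has degree 6.

   A definite center forces every nonzero form l with l(A) = 0 to be indefinite.  A half-space
   containing X_A in the chart l = 1 would give a second such form m with m l >= 0 everywhere;
   then m vanishes where l does, so m is a multiple of l, which is impossible. *)

theory Submission
  imports Defs "HOL-Computational_Algebra.Fundamental_Theorem_Algebra"
    "HOL-Library.Quadratic_Discriminant"
begin

section \<open>Evaluation of multivariate polynomials\<close>

text \<open>Three points lie behind the degree 6 claim. First, points of X_A have complex
  parameters, and a real point must be shown to come from a real one: if t = a + i b gives a real
  point, then a b^T + b a^T lies on the line through A, but its rank is at most 2 while A has rank
  3, so a or b vanishes. Second, a boundary point has a double root because a supporting functional,
  restricted to squares, is a positive semidefinite form with a Hankel matrix; if its face contains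
  two different squares, that matrix has rank 1 and the functional is evaluation at a point, the
  common double root. Third, density is an explicit parametrization argument: every complex zero of
  the discriminant is (a + b x)^2 (c + d x + e x^2), and the real parameters that give boundary
  points contain a product of infinite sets, so a polynomial vanishing on the boundary vanishes for
  all complex parameters. The degree of a hypersurface refers to a squarefree equation;
  squarefreeness is tested on one pencil of quartics where the discriminant has only simple
  zeros.\<close>

definition monom_eval :: "('n::finite \<Rightarrow>\<^sub>0 nat) \<Rightarrow> complex^'n \<Rightarrow> complex" where
  "monom_eval m v = (\<Prod>i\<in>UNIV. (v $ i) ^ Poly_Mapping.lookup m i)"

lemma monom_eval_add: "monom_eval (m + m') v = monom_eval m v * monom_eval m' v"
  by (simp add: monom_eval_def lookup_add power_add prod.distrib)

lemma monom_eval_0 [simp]: "monom_eval 0 v = 1"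
  by (simp add: monom_eval_def)

lemma mpoly_eval_superset:
  assumes "finite S" "Poly_Mapping.keys p \<subseteq> S"
  shows "mpoly_eval p v = (\<Sum>m\<in>S. Poly_Mapping.lookup p m * monom_eval m v)"
  unfolding mpoly_eval_def monom_eval_def
  by (rule sum.mono_neutral_left) (use assms in \<open>auto simp: in_keys_iff\<close>)

lemma mpoly_eval_0 [simp]: "mpoly_eval 0 v = 0"
  by (simp add: mpoly_eval_def)

lemma mpoly_eval_single [simp]: "mpoly_eval (Poly_Mapping.single m c) v = c * monom_eval m v"
  by (subst mpoly_eval_superset[of "{m}"]) auto

lemma mpoly_eval_add: "mpoly_eval (p + q) v = mpoly_eval p v + mpoly_eval q v"
proof -
  let ?S = "Poly_Mapping.keys p \<union> Poly_Mapping.keys q"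
  have "mpoly_eval (p + q) v = (\<Sum>m\<in>?S. Poly_Mapping.lookup (p + q) m * monom_eval m v)"
    using Poly_Mapping.keys_add[of p q] by (intro mpoly_eval_superset) auto
  also have "\<dots> = (\<Sum>m\<in>?S. Poly_Mapping.lookup p m * monom_eval m v)
      + (\<Sum>m\<in>?S. Poly_Mapping.lookup q m * monom_eval m v)"
    by (simp add: lookup_add algebra_simps sum.distrib)
  also have "\<dots> = mpoly_eval p v + mpoly_eval q v"
    by (simp add: mpoly_eval_superset[symmetric])
  finally show ?thesis .
qed

lemma mpoly_eval_sum: "mpoly_eval (sum f I) v = (\<Sum>i\<in>I. mpoly_eval (f i) v)"
  by (induction I rule: infinite_finite_induct) (auto simp: mpoly_eval_add)

lemma poly_mapping_sum_single:
  "(\<Sum>m\<in>Poly_Mapping.keys p. Poly_Mapping.single m (Poly_Mapping.lookup p m)) = p"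
proof (rule poly_mapping_eqI)
  fix k
  have "(\<Sum>m\<in>Poly_Mapping.keys p. Poly_Mapping.lookup p m when m = k) = Poly_Mapping.lookup p k"
    by (cases "k \<in> Poly_Mapping.keys p") (auto simp: when_def in_keys_iff)
  then show "Poly_Mapping.lookup
      (\<Sum>m\<in>Poly_Mapping.keys p. Poly_Mapping.single m (Poly_Mapping.lookup p m)) k =
      Poly_Mapping.lookup p k"
    by (simp add: lookup_sum lookup_single)
qed

lemma mpoly_eval_mult: "mpoly_eval (p * q) v = mpoly_eval p v * mpoly_eval q v"
proof -
  let ?s = "\<lambda>p::'a mpoly. \<Sum>m\<in>Poly_Mapping.keys p. Poly_Mapping.single m (Poly_Mapping.lookup p m)"
  have "mpoly_eval (?s p * ?s q) v = mpoly_eval (?s p) v * mpoly_eval (?s q) v"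
    by (simp only: sum_product mult_single mpoly_eval_sum mpoly_eval_single monom_eval_add)
      (simp add: mult_ac)
  then show ?thesis by (simp only: poly_mapping_sum_single)
qed

lemma mpoly_eval_scale:
  assumes "homogeneous d p"
  shows "mpoly_eval p (c *s v) = c ^ d * mpoly_eval p v"
proof -
  have "monom_eval m (c *s v) = c ^ (\<Sum>i\<in>UNIV. Poly_Mapping.lookup m i) * monom_eval m v" for m
    by (simp add: monom_eval_def power_mult_distrib prod.distrib power_sum)
  then show ?thesis
    using assms
    by (simp add: mpoly_eval_superset[OF finite_keys order_refl] homogeneous_def sum_distrib_left mult_ac)
qed

text \<open>Induction on the set of variables: with the others frozen, the sum is a univariate
  polynomial in the new variable that vanishes everywhere, so each of its coefficients vanishes.
  Terms that agree on \<open>I\<close> are lumped together; once \<open>I\<close> is the whole type,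
  each class is a single monomial.\<close>

lemma vanishing_monom_sum:
  fixes a :: "('n \<Rightarrow> nat) \<Rightarrow> complex"
  assumes "finite I" "finite S"
    and "\<And>v. (\<Sum>m\<in>S. a m * (\<Prod>i\<in>I. v i ^ m i)) = 0"
  shows "(\<Sum>m\<in>{m\<in>S. \<forall>i\<in>I. m i = m0 i}. a m) = 0"
  using assms
proof (induction I arbitrary: S rule: finite_induct)
  case empty
  then show ?case by simp
next
  case (insert j I)
  let ?S = "{m\<in>S. m j = m0 j}"
  have "(\<Sum>m\<in>?S. a m * (\<Prod>i\<in>I. v i ^ m i)) = 0" for v
  proof -
    define b where "b m = a m * (\<Prod>i\<in>I. v i ^ m i)" for m
    define P where "P = (\<Sum>m\<in>S. monom (b m) (m j))"
    have "poly P z = 0" for z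
    proof -
      have "poly P z = (\<Sum>m\<in>S. b m * z ^ m j)"
        by (simp add: P_def poly_sum poly_monom)
      also have "\<dots> = (\<Sum>m\<in>S. a m * (\<Prod>i\<in>insert j I. (v(j := z)) i ^ m i))"
      proof (rule sum.cong[OF refl])
        fix m
        have "(\<Prod>i\<in>I. (v(j := z)) i ^ m i) = (\<Prod>i\<in>I. v i ^ m i)"
          by (rule prod.cong) (use insert.hyps in auto)
        then show "b m * z ^ m j = a m * (\<Prod>i\<in>insert j I. (v(j := z)) i ^ m i)"
          using insert.hyps by (simp add: b_def)
      qed
      also have "\<dots> = 0" by (rule insert.prems)
      finally show ?thesis .
    qed
    then have "P = 0" using poly_all_0_iff_0 by blast
    then have "0 = coeff P (m0 j)" by simp
    also have "\<dots> = (\<Sum>m\<in>S. if m j = m0 j then b m else 0)"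
      by (simp add: P_def coeff_sum)
    also have "\<dots> = (\<Sum>m\<in>?S. b m)"
      using insert.prems by (simp add: sum.If_cases Int_def)
    finally show ?thesis by (simp add: b_def)
  qed
  then have "(\<Sum>m\<in>{m\<in>?S. \<forall>i\<in>I. m i = m0 i}. a m) = 0"
    using insert.prems by (intro insert.IH) auto
  moreover have "{m\<in>?S. \<forall>i\<in>I. m i = m0 i} = {m\<in>S. \<forall>i\<in>insert j I. m i = m0 i}"
    by auto
  ultimately show ?case by simp
qed

lemma mpoly_eval_zero_imp_zero:
  assumes "\<And>v. mpoly_eval p v = 0"
  shows "p = 0"
proof (rule ccontr)
  assume "p \<noteq> 0"
  then obtain m0 where m0: "m0 \<in> Poly_Mapping.keys p"
    using keys_eq_empty by blast
  let ?K = "Poly_Mapping.keys p" and ?l = "Poly_Mapping.lookup :: ('a \<Rightarrow>\<^sub>0 nat) \<Rightarrow> 'a \<Rightarrow> nat"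
  \<comment> \<open>The preceding lemma indexes monomials by plain functions, so the coefficients
    are transported along the injective map \<open>lookup\<close>.\<close>
  define a where "a f = Poly_Mapping.lookup p (Poly_Mapping.Abs_poly_mapping f)" for f
  have inj: "inj_on ?l ?K" by (rule inj_onI) (rule poly_mapping_eqI, simp)
  have a: "a (?l m) = Poly_Mapping.lookup p m" for m by (simp add: a_def)
  have "(\<Sum>f\<in>{f\<in>?l ` ?K. \<forall>i\<in>UNIV. f i = ?l m0 i}. a f) = 0"
  proof (rule vanishing_monom_sum)
    fix v :: "'a \<Rightarrow> complex"
    have "(\<Sum>f\<in>?l ` ?K. a f * (\<Prod>i\<in>UNIV. v i ^ f i)) = mpoly_eval p (\<chi> i. v i)"
      by (simp add: sum.reindex[OF inj] a mpoly_eval_def)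
    then show "(\<Sum>f\<in>?l ` ?K. a f * (\<Prod>i\<in>UNIV. v i ^ f i)) = 0" by (simp add: assms)
  qed auto
  moreover have "{f\<in>?l ` ?K. \<forall>i\<in>UNIV. f i = ?l m0 i} = {?l m0}"
    using m0 by (simp add: fun_eq_iff[symmetric]) blast
  ultimately have "Poly_Mapping.lookup p m0 = 0" by (simp add: a)
  then show False using m0 by (simp add: in_keys_iff)
qed

text \<open>Homogeneity is attached to functions so that the degree of the discriminant can be read
  off its formula by closure rules; an actual polynomial is extracted only at the end.\<close>

definition homogeneous_fun :: "nat \<Rightarrow> (complex^'n::finite \<Rightarrow> complex) \<Rightarrow> bool" where
  "homogeneous_fun d F \<longleftrightarrow> (\<exists>p. homogeneous d p \<and> (\<forall>v. mpoly_eval p v = F v))"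

lemma homogeneous_fun_add:
  assumes "homogeneous_fun d F" "homogeneous_fun d G"
  shows "homogeneous_fun d (\<lambda>v. F v + G v)"
proof -
  obtain p q where "homogeneous d p" "homogeneous d q"
    and ev: "\<And>v. mpoly_eval p v = F v" "\<And>v. mpoly_eval q v = G v"
    using assms by (auto simp: homogeneous_fun_def)
  then have "homogeneous d (p + q)"
    unfolding homogeneous_def using Poly_Mapping.keys_add[of p q] by (meson UnE subsetD)
  then show ?thesis
    unfolding homogeneous_fun_def using ev by (intro exI[of _ "p + q"]) (simp add: mpoly_eval_add)
qed

lemma homogeneous_fun_mult:
  assumes "homogeneous_fun d F" "homogeneous_fun e G"
  shows "homogeneous_fun (d + e) (\<lambda>v. F v * G v)"
proof -
  obtain p q where hom: "homogeneous d p" "homogeneous e q"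
    and ev: "\<And>v. mpoly_eval p v = F v" "\<And>v. mpoly_eval q v = G v"
    using assms by (auto simp: homogeneous_fun_def)
  have "homogeneous (d + e) (p * q)"
    unfolding homogeneous_def
  proof
    fix m assume "m \<in> Poly_Mapping.keys (p * q)"
    then obtain a b where "m = a + b" "a \<in> Poly_Mapping.keys p" "b \<in> Poly_Mapping.keys q"
      using Poly_Mapping.keys_mult[of p q] by auto
    then show "(\<Sum>i\<in>UNIV. Poly_Mapping.lookup m i) = d + e"
      using hom by (simp add: lookup_add sum.distrib homogeneous_def)
  qed
  then show ?thesis
    unfolding homogeneous_fun_def using ev by (intro exI[of _ "p * q"]) (simp add: mpoly_eval_mult)
qed

lemma homogeneous_fun_const: "homogeneous_fun 0 (\<lambda>v. c)"
  unfolding homogeneous_fun_def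
  by (rule exI[of _ "Poly_Mapping.single 0 c"]) (auto simp: homogeneous_def)

lemma homogeneous_fun_cmult:
  assumes "homogeneous_fun d F"
  shows "homogeneous_fun d (\<lambda>v. c * F v)"
  using homogeneous_fun_mult[OF homogeneous_fun_const assms] by simp

lemma homogeneous_fun_diff:
  assumes "homogeneous_fun d F" "homogeneous_fun d G"
  shows "homogeneous_fun d (\<lambda>v. F v - G v)"
  using homogeneous_fun_add[OF assms(1) homogeneous_fun_cmult[OF assms(2), of "-1"]] by simp

lemma homogeneous_fun_power:
  assumes "homogeneous_fun d F"
  shows "homogeneous_fun (k * d) (\<lambda>v. F v ^ k)"
proof (induction k)
  case 0
  show ?case using homogeneous_fun_const[of 1] by simp
next
  case (Suc k)
  then show ?case using homogeneous_fun_mult[OF assms Suc] by (simp add: add.commute)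
qed

lemma homogeneous_fun_zero: "homogeneous_fun d (\<lambda>v. 0)"
  unfolding homogeneous_fun_def by (rule exI[of _ 0]) (simp add: homogeneous_def)

lemma homogeneous_fun_sum:
  assumes "\<And>i. i \<in> I \<Longrightarrow> homogeneous_fun d (F i)"
  shows "homogeneous_fun d (\<lambda>v. \<Sum>i\<in>I. F i v)"
  using assms
proof (induction I rule: infinite_finite_induct)
  case (insert i I)
  then show ?case by (simp add: homogeneous_fun_add)
qed (simp_all add: homogeneous_fun_zero)

lemma homogeneous_fun_nth: "homogeneous_fun 1 (\<lambda>v. v $ i)"
proof -
  let ?m = "Poly_Mapping.single i (1::nat)"
  have "(\<Prod>k\<in>UNIV. (v $ k) ^ Poly_Mapping.lookup ?m k) = v $ i" for v :: "complex^'a"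
  proof -
    have "(\<Prod>k\<in>UNIV. (v $ k) ^ Poly_Mapping.lookup ?m k) = (\<Prod>k\<in>UNIV. if k = i then v $ i else 1)"
      by (rule prod.cong) (auto simp: lookup_single when_def)
    then show ?thesis by simp
  qed
  moreover have "(\<Sum>k\<in>UNIV. Poly_Mapping.lookup ?m k) = 1"
    by (simp add: lookup_single when_def)
  ultimately show ?thesis
    unfolding homogeneous_fun_def
    by (intro exI[of _ "Poly_Mapping.single ?m 1"]) (auto simp: homogeneous_def monom_eval_def)
qed

text \<open>Multivariate polynomials are studied through their restrictions to lines and to single
  parameters, where finiteness of the root set and the fundamental theorem of algebra apply.\<close>

definition is_poly_fun :: "(complex \<Rightarrow> complex) \<Rightarrow> bool" where
  "is_poly_fun h \<longleftrightarrow> (\<exists>P. \<forall>z. h z = poly P z)"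

lemma is_poly_fun_const [intro!]: "is_poly_fun (\<lambda>z. c)"
  unfolding is_poly_fun_def by (rule exI[of _ "[:c:]"]) auto

lemma is_poly_fun_id [intro!]: "is_poly_fun (\<lambda>z. z)"
  unfolding is_poly_fun_def by (rule exI[of _ "[:0, 1:]"]) auto

lemma is_poly_fun_add [intro!]:
  "is_poly_fun f \<Longrightarrow> is_poly_fun g \<Longrightarrow> is_poly_fun (\<lambda>z. f z + g z)"
  unfolding is_poly_fun_def by (elim exE, simp only:, simp only: poly_add[symmetric], blast)

lemma is_poly_fun_diff [intro!]:
  "is_poly_fun f \<Longrightarrow> is_poly_fun g \<Longrightarrow> is_poly_fun (\<lambda>z. f z - g z)"
  unfolding is_poly_fun_def by (elim exE, simp only:, simp only: poly_diff[symmetric], blast)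

lemma is_poly_fun_mult [intro!]:
  "is_poly_fun f \<Longrightarrow> is_poly_fun g \<Longrightarrow> is_poly_fun (\<lambda>z. f z * g z)"
  unfolding is_poly_fun_def by (elim exE, simp only:, simp only: poly_mult[symmetric], blast)

lemma is_poly_fun_power [intro!]: "is_poly_fun f \<Longrightarrow> is_poly_fun (\<lambda>z. f z ^ k)"
  unfolding is_poly_fun_def by (elim exE, simp only:, simp only: poly_power[symmetric], blast)

lemma is_poly_fun_sum [intro!]:
  assumes "\<And>i. i \<in> I \<Longrightarrow> is_poly_fun (f i)"
  shows "is_poly_fun (\<lambda>z. \<Sum>i\<in>I. f i z)"
  using assms by (induction I rule: infinite_finite_induct) auto

lemma is_poly_fun_prod [intro!]:
  assumes "\<And>i. i \<in> I \<Longrightarrow> is_poly_fun (f i)"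
  shows "is_poly_fun (\<lambda>z. \<Prod>i\<in>I. f i z)"
  using assms by (induction I rule: infinite_finite_induct) auto

lemma is_poly_fun_mpoly_eval:
  assumes "\<And>i. is_poly_fun (\<lambda>z. \<gamma> z $ i)"
  shows "is_poly_fun (\<lambda>z. mpoly_eval p (\<gamma> z))"
  unfolding mpoly_eval_def using assms
  by (intro is_poly_fun_sum is_poly_fun_mult is_poly_fun_prod is_poly_fun_power is_poly_fun_const)

lemma is_poly_fun_zero:
  assumes "is_poly_fun h" "infinite Z" "\<And>z. z \<in> Z \<Longrightarrow> h z = 0"
  shows "h z = 0"
proof -
  obtain P where P: "\<And>z. h z = poly P z" using assms(1) by (auto simp: is_poly_fun_def)
  have "infinite {z. poly P z = 0}"
    using assms(2,3) P by (metis (mono_tags, lifting) finite_subset mem_Collect_eq subsetI)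
  then have "P = 0" using poly_roots_finite by blast
  then show ?thesis by (simp add: P)
qed

lemma is_poly_fun_nonvanishing:
  assumes "is_poly_fun h" "\<And>z. h z \<noteq> 0"
  shows "h z = h w"
proof -
  obtain P where P: "\<And>z. h z = poly P z" using assms(1) by (auto simp: is_poly_fun_def)
  then have "\<not> (\<exists>z. poly P z = 0)" using assms(2) by simp
  then have "constant (poly P)" using fundamental_theorem_of_algebra by blast
  then show ?thesis unfolding P constant_def by blast
qed

lemma is_poly_fun_DERIV:
  assumes "is_poly_fun h"
  obtains h' where "\<And>z. (h has_field_derivative h' z) (at z)"
proof -
  obtain P where P: "h = poly P" using assms(1) by (auto simp: is_poly_fun_def)
  show thesis
    by (rule that[of "poly (pderiv P)"]) (simp add: P poly_DERIV)
qed

section \<open>Binary quartics\<close>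

lemma exhaust_5:
  fixes x :: 5
  shows "x = 1 \<or> x = 2 \<or> x = 3 \<or> x = 4 \<or> x = 5"
proof (induct x)
  case (of_int z)
  then have "z = 0 \<or> z = 1 \<or> z = 2 \<or> z = 3 \<or> z = 4" by auto
  then show ?case by auto
qed

lemma forall_5: "(\<forall>i::5. P i) \<longleftrightarrow> P 1 \<and> P 2 \<and> P 3 \<and> P 4 \<and> P 5"
  by (metis exhaust_5)

lemma UNIV_5: "UNIV = {1, 2, 3, 4, 5::5}"
  using exhaust_5 by auto

lemma sum_5: "sum f (UNIV::5 set) = f 1 + f 2 + f 3 + f 4 + f 5"
  unfolding UNIV_5 by (simp add: ac_simps)

text \<open>The vector \<open>quartic c0 c1 c2 c3 c4\<close> stands for \<open>c0 + c1 x + c2 x^2 + c3 x^3 + c4 x^4\<close>, read as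
  a binary form of degree 4, so that infinity is a root when \<open>c4 = 0\<close>.\<close>

definition quartic :: "'a \<Rightarrow> 'a \<Rightarrow> 'a \<Rightarrow> 'a \<Rightarrow> 'a \<Rightarrow> 'a^5" where
  "quartic c0 c1 c2 c3 c4 =
     (\<chi> i. if i = 1 then c0 else if i = 2 then c1 else if i = 3 then c2 else if i = 4 then c3 else c4)"

lemma quartic_nth [simp]:
  "quartic c0 c1 c2 c3 c4 $ 1 = c0" "quartic c0 c1 c2 c3 c4 $ 2 = c1"
  "quartic c0 c1 c2 c3 c4 $ 3 = c2" "quartic c0 c1 c2 c3 c4 $ 4 = c3"
  "quartic c0 c1 c2 c3 c4 $ 5 = c4"
  by (simp_all add: quartic_def)

lemma quartic_eqI: "q = quartic (q $ 1) (q $ 2) (q $ 3) (q $ 4) (q $ 5)"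
  by (simp add: vec_eq_iff forall_5)

text \<open>The classical quadratic invariant of a binary quartic: with coefficients a, 4b, 6c, 4d,
  e it is 12 (a e - 4 b d + 3 c^2).\<close>

definition invI :: "'a::comm_ring_1^5 \<Rightarrow> 'a" where
  "invI q = 12 * (q $ 1) * (q $ 5) - 3 * (q $ 2) * (q $ 4) + (q $ 3)^2"

text \<open>The classical cubic invariant, the catalecticant: with coefficients a, 4b, 6c, 4d, e it
  is 432 times the determinant of the Hankel matrix of a, b, c, d, e.\<close>

definition invJ :: "'a::comm_ring_1^5 \<Rightarrow> 'a" where
  "invJ q = 72 * (q $ 1) * (q $ 3) * (q $ 5) + 9 * (q $ 2) * (q $ 3) * (q $ 4)
     - 27 * (q $ 1) * (q $ 4)^2 - 27 * (q $ 5) * (q $ 2)^2 - 2 * (q $ 3)^3"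

text \<open>This is 27 times the discriminant.\<close>

definition qdisc :: "'a::comm_ring_1^5 \<Rightarrow> 'a" where
  "qdisc q = 4 * invI q ^ 3 - invJ q ^ 2"

text \<open>\<open>(a + b x)^2 (c + d x + e x^2)\<close>\<close>

definition dbl :: "'a::comm_ring_1 \<Rightarrow> 'a \<Rightarrow> 'a \<Rightarrow> 'a \<Rightarrow> 'a \<Rightarrow> 'a^5" where
  "dbl a b c d e = quartic (a^2 * c) (a^2 * d + 2*a*b*c) (a^2 * e + 2*a*b*d + b^2 * c)
     (2*a*b*e + b^2 * d) (b^2 * e)"

text \<open>\<open>(s0 + s1 x + s2 x^2)^2\<close>\<close>

definition qsq :: "'a::comm_ring_1 \<Rightarrow> 'a \<Rightarrow> 'a \<Rightarrow> 'a^5" where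
  "qsq s0 s1 s2 = quartic (s0^2) (2 * s0 * s1) (2 * s0 * s2 + s1^2) (2 * s1 * s2) (s2^2)"

text \<open>Both invariants are powers of w = a^2 e - a b d + b^2 c, the resultant of the linear and
  the quadratic factor: I = w^2 and J = -2 w^3.\<close>

lemma qdisc_dbl: "qdisc (dbl a b c d e) = 0"
proof -
  have "invI (dbl a b c d e) = (a^2 * e - a*b*d + b^2 * c)^2"
    unfolding invI_def dbl_def quartic_nth by (simp add: power2_eq_square power3_eq_cube algebra_simps)
  moreover have "invJ (dbl a b c d e) = - 2 * (a^2 * e - a*b*d + b^2 * c)^3"
    unfolding invJ_def dbl_def quartic_nth by (simp add: power2_eq_square power3_eq_cube algebra_simps)
  ultimately show ?thesis by (simp add: qdisc_def power_mult_distrib flip: power_mult)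
qed

text \<open>Separate from \<open>qdisc_dbl\<close> because a real quadratic may have no real root,
  and its square is then not of the form \<open>dbl\<close> over the reals. The discriminant of the
  quadratic, scaled by \<open>c\<close>, takes the place of the resultant.\<close>

lemma qdisc_scaled_square: "qdisc (c *s qsq s0 s1 s2) = 0"
proof -
  have "invI (c *s qsq s0 s1 s2) = (c * (s1^2 - 4 * s0 * s2))^2"
    unfolding invI_def qsq_def vector_smult_component quartic_nth by (simp add: power2_eq_square power3_eq_cube algebra_simps)
  moreover have "invJ (c *s qsq s0 s1 s2) = - 2 * (c * (s1^2 - 4 * s0 * s2))^3"
    unfolding invJ_def qsq_def vector_smult_component quartic_nth by (simp add: power2_eq_square power3_eq_cube algebra_simps)
  ultimately show ?thesis by (simp add: qdisc_def power_mult_distrib flip: power_mult)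
qed

section \<open>Factorization of complex forms with vanishing discriminant\<close>

definition cubic_disc :: "complex \<Rightarrow> complex \<Rightarrow> complex \<Rightarrow> complex \<Rightarrow> complex" where
  "cubic_disc c0 c1 c2 c3 =
     c1^2 * c2^2 - 4*c0*c2^3 - 4*c1^3*c3 + 18*c0*c1*c2*c3 - 27*c0^2*c3^2"

text \<open>The argument is the product of x - r with a cubic; the discriminant of a product is the
  product of the discriminants times the squared resultant, here the value of the cubic at r. The
  next lemma is the same rule for a root at infinity.\<close>

lemma qdisc_linear_factor:
  "qdisc (quartic (- r*c0) (c0 - r*c1) (c1 - r*c2) (c2 - r*c3) c3) =
     27 * (c0 + c1*r + c2*r^2 + c3*r^3)^2 * cubic_disc c0 c1 c2 c3"
  unfolding qdisc_def invI_def invJ_def quartic_nth cubic_disc_def by (simp add: power2_eq_square power3_eq_cube algebra_simps)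

lemma qdisc_degenerate: "qdisc (quartic c0 c1 c2 c3 0) = 27 * c3^2 * cubic_disc c0 c1 c2 c3"
  unfolding qdisc_def invI_def invJ_def quartic_nth cubic_disc_def by (simp add: power2_eq_square power3_eq_cube algebra_simps)

lemma cubic_disc_linear_factor:
  "cubic_disc (- r*c0) (c0 - r*c1) (c1 - r*c2) c2 = (c0 + c1*r + c2*r^2)^2 * (c1^2 - 4*c0*c2)"
  unfolding cubic_disc_def by (simp add: power2_eq_square power3_eq_cube algebra_simps)

lemma cubic_disc_degenerate: "cubic_disc c0 c1 c2 0 = c2^2 * (c1^2 - 4*c0*c2)"
  unfolding cubic_disc_def by (simp add: power2_eq_square power3_eq_cube algebra_simps)

text \<open>Either infinity is a root, or synthetic division by x - r at a finite root r yields the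
  cubic with coefficients d0, d1, d2, c4.\<close>

lemma quartic_split:
  fixes c0 c1 c2 c3 c4 :: complex
  shows "c4 = 0 \<or> (\<exists>r d0 d1 d2. c0 = - r*d0 \<and> c1 = d0 - r*d1 \<and> c2 = d1 - r*d2 \<and> c3 = d2 - r*c4)"
proof (cases "c4 = 0")
  case False
  then have "\<not> constant (poly [:c0, c1, c2, c3, c4:])"
    by (simp add: constant_degree)
  then obtain r where "poly [:c0, c1, c2, c3, c4:] r = 0"
    using fundamental_theorem_of_algebra by blast
  then have r: "c0 + r * (c1 + r * (c2 + r * (c3 + r * c4))) = 0" by simp
  define d2 where "d2 = c3 + r * c4"
  define d1 where "d1 = c2 + r * d2"
  define d0 where "d0 = c1 + r * d1"
  have "c0 = - r*d0" using r unfolding d0_def d1_def d2_def by (simp add: add_eq_0_iff2)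
  then show ?thesis by (intro disjI2 exI[of _ r] exI[of _ d0] exI[of _ d1] exI[of _ d2])
      (simp add: d0_def d1_def d2_def)
qed auto

lemma cubic_split:
  fixes c0 c1 c2 c3 :: complex
  shows "c3 = 0 \<or> (\<exists>r d0 d1. c0 = - r*d0 \<and> c1 = d0 - r*d1 \<and> c2 = d1 - r*c3)"
proof (cases "c3 = 0")
  case False
  then have "\<not> constant (poly [:c0, c1, c2, c3:])"
    by (simp add: constant_degree)
  then obtain r where "poly [:c0, c1, c2, c3:] r = 0"
    using fundamental_theorem_of_algebra by blast
  then have r: "c0 + r * (c1 + r * (c2 + r * c3)) = 0" by simp
  define d1 where "d1 = c2 + r * c3"
  define d0 where "d0 = c1 + r * d1"
  have "c0 = - r*d0" using r unfolding d0_def d1_def by (simp add: add_eq_0_iff2)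
  then show ?thesis by (intro disjI2 exI[of _ r] exI[of _ d0] exI[of _ d1])
      (simp add: d0_def d1_def)
qed auto

lemma linear_factor_of_root:
  fixes c0 c1 c2 c3 r :: complex
  assumes "c0 + c1*r + c2*r^2 + c3*r^3 = 0"
  shows "c0 = - r * (c1 + r * (c2 + r * c3))"
proof -
  have "c0 + r * (c1 + r * (c2 + r * c3)) = 0"
    using assms by (simp add: power2_eq_square power3_eq_cube algebra_simps)
  then show ?thesis by (simp add: eq_neg_iff_add_eq_0)
qed

lemma perfect_square_of_disc_0:
  fixes c0 c1 c2 :: complex
  assumes "c1^2 - 4*c0*c2 = 0"
  obtains a b where "c0 = a^2" "c1 = 2*a*b" "c2 = b^2"
proof -
  obtain a where a: "a^2 = c0" using power2_csqrt by blast
  obtain b where b: "b^2 = c2" using power2_csqrt by blast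
  have "c1^2 = (2*a*b)^2" using assms by (simp add: power_mult_distrib a b)
  then consider "c1 = 2*a*b" | "c1 = 2*a*(-b)" by (auto simp: power2_eq_iff)
  then show thesis
    by cases (use that[of a b] that[of a "-b"] a b in auto)
qed

text \<open>The conclusion lists the coefficients of (a + b x)^2 (e + f x). After splitting off one
  root, possibly infinite, either that root recurs in the quadratic cofactor or the cofactor is
  itself a square.\<close>

lemma cubic_disc_0_imp_double_root:
  assumes "cubic_disc c0 c1 c2 c3 = 0"
  obtains a b e f where "c0 = a^2 * e" "c1 = 2*a*b*e + a^2 * f" "c2 = b^2 * e + 2*a*b*f" "c3 = b^2 * f"
proof -
  from cubic_split[of c3 c0 c1 c2] show thesis
  proof (elim disjE exE conjE)
    assume c3: "c3 = 0"
    then have "c2^2 * (c1^2 - 4*c0*c2) = 0" using assms by (simp add: cubic_disc_degenerate)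
    then consider "c2 = 0" | "c1^2 - 4*c0*c2 = 0" by auto
    then show thesis
    proof cases
      case 1
      then show thesis using that[of 1 c0 0 c1] c3 by simp
    next
      case 2
      then obtain a b where "c0 = a^2" "c1 = 2*a*b" "c2 = b^2" by (rule perfect_square_of_disc_0)
      then show thesis using that[of a 1 b 0] c3 by simp
    qed
  next
    fix r d0 d1
    assume c: "c0 = - r*d0" "c1 = d0 - r*d1" "c2 = d1 - r*c3"
    have "(d0 + d1*r + c3*r^2)^2 * (d1^2 - 4*d0*c3) = 0"
      using assms unfolding c cubic_disc_linear_factor .
    then consider "d0 + d1*r + c3*r^2 = 0" | "d1^2 - 4*d0*c3 = 0" by auto
    then show thesis
    proof cases
      case 1
      then have d0: "d0 = - r * (d1 + c3 * r)"
        by (simp add: power2_eq_square algebra_simps eq_neg_iff_add_eq_0)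
      show thesis
        by (rule that[of "-r" "d1 + c3*r" 1 c3])
          (simp_all add: c d0 power2_eq_square algebra_simps)
    next
      case 2
      then obtain a b where "d0 = a^2" "d1 = 2*a*b" "c3 = b^2" by (rule perfect_square_of_disc_0)
      then show thesis
        by (intro that[of a "-r" b 1]) (simp_all add: c power2_eq_square algebra_simps)
    qed
  qed
qed

text \<open>One root is split off, possibly at infinity. Either it recurs in the cubic cofactor, or
  the cofactor has vanishing discriminant and supplies the double root. This makes the complex
  parametrization by \<open>dbl\<close> surjective onto the discriminant locus.\<close>

lemma qdisc_0_imp_dbl:
  fixes q :: "complex^5"
  assumes "qdisc q = 0"
  obtains a b c d e where "q = dbl a b c d e"
proof -
  define c0 c1 c2 c3 c4 where cdef: "c0 = q $ 1" "c1 = q $ 2" "c2 = q $ 3" "c3 = q $ 4" "c4 = q $ 5"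
  have q: "q = quartic c0 c1 c2 c3 c4" unfolding cdef by (rule quartic_eqI)
  from quartic_split[of c4 c0 c1 c2 c3] show thesis
  proof (elim disjE exE conjE)
    assume c4: "c4 = 0"
    then have "27 * c3^2 * cubic_disc c0 c1 c2 c3 = 0"
      using assms by (simp add: q qdisc_degenerate)
    then consider "c3 = 0" | "cubic_disc c0 c1 c2 c3 = 0" by auto
    then show thesis
    proof cases
      case 1
      then show thesis using that[of 1 0 c0 c1 c2] c4 by (simp add: q dbl_def)
    next
      case 2
      then obtain a b e f where
        "c0 = a^2 * e" "c1 = 2*a*b*e + a^2 * f" "c2 = b^2 * e + 2*a*b*f" "c3 = b^2 * f"
        by (rule cubic_disc_0_imp_double_root)
      then show thesis using that[of a b e f 0] c4 by (simp add: q dbl_def algebra_simps)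
    qed
  next
    fix r d0 d1 d2
    assume c: "c0 = - r*d0" "c1 = d0 - r*d1" "c2 = d1 - r*d2" "c3 = d2 - r*c4"
    have "27 * (d0 + d1*r + d2*r^2 + c4*r^3)^2 * cubic_disc d0 d1 d2 c4 = 0"
      using assms unfolding q c qdisc_linear_factor .
    then consider "d0 + d1*r + d2*r^2 + c4*r^3 = 0" | "cubic_disc d0 d1 d2 c4 = 0" by auto
    then show thesis
    proof cases
      case 1
      define e1 where "e1 = d2 + r * c4"
      define e0 where "e0 = d1 + r * e1"
      have d: "d0 = - r * e0" "d1 = e0 - r * e1" "d2 = e1 - r * c4"
        using linear_factor_of_root[OF 1] by (simp_all add: e0_def e1_def)
      have "q = dbl (-r) 1 e0 e1 c4"
        unfolding q c d dbl_def by (simp add: power2_eq_square algebra_simps)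
      then show thesis by (rule that)
    next
      case 2
      then obtain a b e f where
        d: "d0 = a^2 * e" "d1 = 2*a*b*e + a^2 * f" "d2 = b^2 * e + 2*a*b*f" "c4 = b^2 * f"
        by (rule cubic_disc_0_imp_double_root)
      have "q = dbl a b (- r*e) (e - r*f) f"
        unfolding q c d dbl_def by (simp add: power2_eq_square algebra_simps)
      then show thesis by (rule that)
    qed
  qed
qed

section \<open>Hypersurfaces\<close>

text \<open>On the line from \<open>v0\<close> to \<open>v\<close> the polynomial \<open>f\<close>
  has only finitely many zeros, so \<open>p - c\<close> has infinitely many zeros there and vanishes
  at \<open>v\<close> too.\<close>

lemma mpoly_eval_nonzero_dense:
  assumes "mpoly_eval f v0 \<noteq> 0" and "\<And>v. mpoly_eval f v \<noteq> 0 \<Longrightarrow> mpoly_eval p v = c"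
  shows "mpoly_eval p v = c"
proof -
  define \<gamma> where "\<gamma> z = v0 + z *s (v - v0)" for z
  have poly: "is_poly_fun (\<lambda>z. mpoly_eval q (\<gamma> z))" for q
    unfolding \<gamma>_def by (rule is_poly_fun_mpoly_eval) auto
  let ?Z = "{z. mpoly_eval f (\<gamma> z) \<noteq> 0}"
  have "infinite ?Z"
  proof
    assume "finite ?Z"
    then have "infinite (- ?Z)"
      using Diff_infinite_finite[OF _ infinite_UNIV_char_0] by (simp only: Compl_eq_Diff_UNIV)
    then have "mpoly_eval f (\<gamma> 0) = 0"
      by (rule is_poly_fun_zero[OF poly]) simp
    then show False using assms(1) by (simp add: \<gamma>_def)
  qed
  then have "mpoly_eval p (\<gamma> 1) - c = 0"
    by (rule is_poly_fun_zero[OF is_poly_fun_diff[OF poly is_poly_fun_const]])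
      (use assms(2) in simp)
  then show ?thesis by (simp add: \<gamma>_def)
qed

lemma has_derivative_0_at_double_zero:
  assumes "is_poly_fun x" "is_poly_fun g" "x z = 0"
  shows "((\<lambda>z. x z ^ 2 * g z) has_field_derivative 0) (at z)"
proof -
  obtain x' where "(x has_field_derivative x' z) (at z)" using is_poly_fun_DERIV[OF assms(1)] by metis
  moreover obtain g' where "(g has_field_derivative g' z) (at z)"
    using is_poly_fun_DERIV[OF assms(2)] by metis
  ultimately show ?thesis
    by (auto intro!: derivative_eq_intros simp: assms(3))
qed

text \<open>If \<open>x^2\<close> divides \<open>f\<close>, every zero of \<open>x\<close> is a singular point of \<open>f\<close>. Hence \<open>x\<close> has no zero
  in the plane spanned by \<open>u\<close> and \<open>w\<close> outside the origin, which forces \<open>x\<close> to be constant there, with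
  \<open>x(0) \<noteq> 0\<close>; as \<open>f\<close> is homogeneous, \<open>x\<close> is then constant on every line through the origin on which
  \<open>f\<close> does not vanish identically.\<close>

lemma squarefree_of_nonsingular_pencil:
  fixes f :: "'n::finite mpoly" and u w :: "complex^'n"
  assumes hom: "homogeneous d f"
    and nonsing: "\<And>s t. mpoly_eval f (s *s u + t *s w) = 0 \<Longrightarrow>
      ((\<lambda>s. mpoly_eval f (s *s u + t *s w)) has_field_derivative 0) (at s) \<Longrightarrow>
      ((\<lambda>t. mpoly_eval f (s *s u + t *s w)) has_field_derivative 0) (at t) \<Longrightarrow> s = 0 \<and> t = 0"
  shows "squarefree f"
  unfolding squarefree_def
proof (intro allI impI)
  fix x assume "x\<^sup>2 dvd f"
  then obtain g where f: "f = x^2 * g" by (elim dvdE)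
  let ?P = "\<lambda>s t. s *s u + t *s w"
  have feval: "mpoly_eval f v = mpoly_eval x v ^ 2 * mpoly_eval g v" for v
    by (simp add: f power2_eq_square mpoly_eval_mult)
  have poly1: "is_poly_fun (\<lambda>s. mpoly_eval p (?P s t))" for p t
    by (rule is_poly_fun_mpoly_eval) auto
  have poly2: "is_poly_fun (\<lambda>t. mpoly_eval p (?P s t))" for p s
    by (rule is_poly_fun_mpoly_eval) auto
  have nz: "mpoly_eval x (?P s t) \<noteq> 0" if "s \<noteq> 0 \<or> t \<noteq> 0" for s t
  proof
    assume 0: "mpoly_eval x (?P s t) = 0"
    have "s = 0 \<and> t = 0"
    proof (rule nonsing)
      show "mpoly_eval f (?P s t) = 0" by (simp add: feval 0)
      show "((\<lambda>s. mpoly_eval f (?P s t)) has_field_derivative 0) (at s)"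
        unfolding feval by (rule has_derivative_0_at_double_zero[OF poly1 poly1 0])
      show "((\<lambda>t. mpoly_eval f (?P s t)) has_field_derivative 0) (at t)"
        unfolding feval by (rule has_derivative_0_at_double_zero[OF poly2 poly2 0])
    qed
    then show False using that by auto
  qed
  \<comment> \<open>A zero-free univariate polynomial is constant. Applied along t = 1 and then
    along each line with fixed s \<noteq> 0, this fixes the value everywhere on t = 0 except at the
    origin, where it follows by polynomial continuation.\<close>
  have c1: "mpoly_eval x (?P s 1) = mpoly_eval x (?P 0 1)" for s
    by (rule is_poly_fun_nonvanishing[OF poly1]) (rule nz, simp)
  have c2: "mpoly_eval x (?P s 0) = mpoly_eval x (?P s 1)" if "s \<noteq> 0" for s
    by (rule is_poly_fun_nonvanishing[OF poly2, where z = 0 and w = 1]) (rule nz, simp add: that)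
  have "mpoly_eval x (?P 0 0) - mpoly_eval x (?P 0 1) = 0"
  proof (rule is_poly_fun_zero[where Z = "UNIV - {0}" and z = 0
        and h = "\<lambda>s. mpoly_eval x (?P s 0) - mpoly_eval x (?P 0 1)"])
    show "is_poly_fun (\<lambda>s. mpoly_eval x (?P s 0) - mpoly_eval x (?P 0 1))"
      by (intro is_poly_fun_diff is_poly_fun_const poly1)
    show "infinite (UNIV - {0 :: complex})" by (simp add: infinite_UNIV_char_0)
    show "mpoly_eval x (?P s 0) - mpoly_eval x (?P 0 1) = 0" if "s \<in> UNIV - {0}" for s
      using c1[of s] c2[of s] that by simp
  qed
  then have x0: "mpoly_eval x 0 \<noteq> 0" using nz[of 0 1] by simp
  have "\<exists>v0. mpoly_eval f v0 \<noteq> 0"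
  proof (rule ccontr)
    assume "\<nexists>v0. mpoly_eval f v0 \<noteq> 0"
    then have "\<And>v. mpoly_eval f v = 0" by blast
    then show False using nonsing[of 1 0] by simp
  qed
  then obtain v0 where v0: "mpoly_eval f v0 \<noteq> 0" by blast
  have const: "mpoly_eval x v = mpoly_eval x 0" if v: "mpoly_eval f v \<noteq> 0" for v
  proof -
    have "mpoly_eval x (1 *s v) = mpoly_eval x (0 *s v)"
    proof (rule is_poly_fun_nonvanishing[of "\<lambda>z. mpoly_eval x (z *s v)"])
      show "is_poly_fun (\<lambda>z. mpoly_eval x (z *s v))"
        by (rule is_poly_fun_mpoly_eval) auto
      show "mpoly_eval x (z *s v) \<noteq> 0" for z
      proof (cases "z = 0")
        case True
        then show ?thesis using x0 by simp
      next
        case False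
        then have "mpoly_eval f (z *s v) \<noteq> 0" using v by (simp add: mpoly_eval_scale[OF hom])
        then show ?thesis by (auto simp: feval)
      qed
    qed
    then show ?thesis by simp
  qed
  define c where "c = mpoly_eval x 0"
  have "mpoly_eval x v = c" for v
    by (rule mpoly_eval_nonzero_dense[OF v0]) (simp add: const c_def)
  then have "mpoly_eval (x + Poly_Mapping.single 0 (- c)) v = 0" for v
    by (simp add: mpoly_eval_add)
  then have "x + Poly_Mapping.single 0 (- c) = 0" by (rule mpoly_eval_zero_imp_zero)
  then have "x = Poly_Mapping.single 0 c" by (simp add: single_uminus)
  moreover have "Poly_Mapping.single 0 c * Poly_Mapping.single 0 (1 / c) = (1 :: 'n mpoly)"
    using x0 by (simp add: mult_single c_def)
  ultimately have "x * Poly_Mapping.single 0 (1 / c) = 1" by simp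
  then show "x dvd 1" by (metis dvd_triv_left)
qed

section \<open>Zero loci and Zariski closure\<close>

lemma pt_in_zero_locus_iff:
  assumes "homogeneous d p" "v \<noteq> 0"
  shows "pt v \<in> zero_locus p \<longleftrightarrow> mpoly_eval p v = 0"
proof
  assume "pt v \<in> zero_locus p"
  then obtain w where w: "pt v = pt w" "mpoly_eval p w = 0" by (auto simp: zero_locus_def)
  have "v \<in> pt v" unfolding pt_def by (rule range_eqI[of _ _ 1]) simp
  then have "v \<in> pt w" by (simp only: w(1))
  then obtain c where "v = c *s w" by (auto simp: pt_def)
  then show "mpoly_eval p v = 0" using mpoly_eval_scale[OF assms(1)] w(2) by simp
next
  show "mpoly_eval p v = 0 \<Longrightarrow> pt v \<in> zero_locus p"
    using assms(2) by (auto simp: zero_locus_def)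
qed

lemma zariski_closure_eq_zero_locus:
  assumes "homogeneous d f" "S \<subseteq> zero_locus f"
    and "\<And>e p v. homogeneous e p \<Longrightarrow> S \<subseteq> zero_locus p \<Longrightarrow> v \<noteq> 0 \<Longrightarrow> mpoly_eval f v = 0 \<Longrightarrow>
      mpoly_eval p v = 0"
  shows "zariski_closure S = zero_locus f"
proof
  show "zariski_closure S \<subseteq> zero_locus f"
    unfolding zariski_closure_def using assms(1,2) by blast
  have "zero_locus f \<subseteq> zero_locus p" if "homogeneous e p" "S \<subseteq> zero_locus p" for e p
    using assms(3)[OF that] by (auto simp: zero_locus_def)
  then show "zero_locus f \<subseteq> zariski_closure S"
    unfolding zariski_closure_def by blast
qed

section \<open>Complexification of real linear maps\<close>

definition cvec :: "real^'n \<Rightarrow> complex^'n" where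
  "cvec y = (\<chi> k. complex_of_real (y $ k))"

text \<open>The complex-linear extension, written through the real matrix so that each coordinate is
  visibly a linear form with constant coefficients.\<close>

definition cext :: "(real^'n \<Rightarrow> real^'m) \<Rightarrow> complex^'n \<Rightarrow> complex^'m" where
  "cext h q = (\<chi> i. \<Sum>k\<in>UNIV. complex_of_real (matrix h $ i $ k) * q $ k)"

lemma cvec_nth [simp]: "cvec y $ k = complex_of_real (y $ k)"
  by (simp add: cvec_def)

lemma cvec_eq_0_iff [simp]: "cvec y = 0 \<longleftrightarrow> y = 0"
  by (simp add: vec_eq_iff)

lemma cvec_scaleR: "cvec (c *\<^sub>R y) = complex_of_real c *s cvec y"
  by (simp add: vec_eq_iff)

lemma real_pt_eq: "real_pt y = pt (cvec y)"
  by (simp add: real_pt_def cvec_def)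

lemma cext_cvec:
  assumes "linear h"
  shows "cext h (cvec q) = cvec (h q)"
proof -
  have "h q = matrix h *v q"
    using assms by (simp add: matrix_works linear_matrix_vector_mul_eq)
  then have "h q $ i = (\<Sum>k\<in>UNIV. matrix h $ i $ k * q $ k)" for i
    by (simp only: matrix_vector_mult_def vec_lambda_beta)
  then show ?thesis by (simp add: vec_eq_iff cext_def)
qed

lemma cext_inverse:
  fixes g :: "real^'m \<Rightarrow> real^'n" and h :: "real^'n \<Rightarrow> real^'m"
  assumes "linear g" "linear h" "\<And>q. g (h q) = q"
  shows "cext g (cext h q) = q"
proof -
  have "matrix g ** matrix h = (mat 1 :: real^'n^'n)"
    using assms matrix_compose[of h g] by (simp add: o_def matrix_id_mat_1[unfolded id_def])
  then have m: "(\<Sum>k\<in>UNIV. matrix g $ i $ k * matrix h $ k $ j) = (if i = j then 1 else 0)" for i j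
    by (simp add: matrix_matrix_mult_def mat_def vec_eq_iff)
  have "cext g (cext h q) $ i = q $ i" for i
  proof -
    have "cext g (cext h q) $ i =
      (\<Sum>k\<in>UNIV. \<Sum>j\<in>UNIV. complex_of_real (matrix g $ i $ k * matrix h $ k $ j) * q $ j)"
      by (simp add: cext_def sum_distrib_left mult.assoc)
    also have "\<dots> = (\<Sum>j\<in>UNIV. complex_of_real (\<Sum>k\<in>UNIV. matrix g $ i $ k * matrix h $ k $ j) * q $ j)"
      by (subst sum.swap) (simp add: sum_distrib_right)
    also have "\<dots> = (\<Sum>j\<in>UNIV. if i = j then q $ j else 0)"
      unfolding m by (rule sum.cong) auto
    finally show ?thesis by simp
  qed
  then show ?thesis by (simp add: vec_eq_iff)
qed

lemma cext_add: "cext h (q + q') = cext h q + cext h q'"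
  by (simp add: cext_def vec_eq_iff algebra_simps sum.distrib)

lemma cext_scale: "cext h (c *s q) = c *s cext h q"
  by (simp add: cext_def vec_eq_iff sum_distrib_left mult_ac)

lemma homogeneous_fun_cext: "homogeneous_fun 1 (\<lambda>v. cext h v $ i)"
  unfolding cext_def vec_lambda_beta
  by (intro homogeneous_fun_sum homogeneous_fun_cmult homogeneous_fun_nth)

lemma is_poly_fun_cext:
  assumes "\<And>i. is_poly_fun (\<lambda>z. \<gamma> z $ i)"
  shows "is_poly_fun (\<lambda>z. cext h (\<gamma> z) $ i)"
  unfolding cext_def vec_lambda_beta using assms
  by (intro is_poly_fun_sum is_poly_fun_mult is_poly_fun_const)

lemma homogeneous_fun_qdisc_cext: "homogeneous_fun 6 (\<lambda>v. qdisc (cext h v :: complex^5))"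
proof -
  note c = homogeneous_fun_cext[of h]
  have c2: "homogeneous_fun 2 (\<lambda>v. a * (cext h v $ i * cext h v $ j))" for a i j
    using homogeneous_fun_cmult[OF homogeneous_fun_mult[OF c c]] by (simp add: numeral_2_eq_2)
  have c3: "homogeneous_fun 3 (\<lambda>v. a * (cext h v $ i * cext h v $ j * cext h v $ k))" for a i j k
    using homogeneous_fun_cmult[OF homogeneous_fun_mult[OF homogeneous_fun_mult[OF c c] c]]
    by (simp add: numeral_3_eq_3)
  have "homogeneous_fun 2 (\<lambda>v. 12 * (cext h v $ 1 * cext h v $ 5) - 3 * (cext h v $ 2 * cext h v $ 4)
      + 1 * (cext h v $ 3 * cext h v $ 3))"
    by (intro homogeneous_fun_add homogeneous_fun_diff c2)
  then have I: "homogeneous_fun 2 (\<lambda>v. invI (cext h v))"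
    by (simp add: invI_def power2_eq_square mult.assoc)
  have "homogeneous_fun 3 (\<lambda>v. 72 * (cext h v $ 1 * cext h v $ 3 * cext h v $ 5)
      + 9 * (cext h v $ 2 * cext h v $ 3 * cext h v $ 4)
      - 27 * (cext h v $ 1 * cext h v $ 4 * cext h v $ 4)
      - 27 * (cext h v $ 5 * cext h v $ 2 * cext h v $ 2)
      - 2 * (cext h v $ 3 * cext h v $ 3 * cext h v $ 3))"
    by (intro homogeneous_fun_add homogeneous_fun_diff c3)
  then have J: "homogeneous_fun 3 (\<lambda>v. invJ (cext h v))"
    by (simp add: invJ_def power2_eq_square power3_eq_cube mult.assoc)
  show ?thesis
    unfolding qdisc_def
    using homogeneous_fun_diff[OF homogeneous_fun_cmult homogeneous_fun_power[OF J, of 2]]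
      homogeneous_fun_power[OF I, of 3] by simp
qed

text \<open>The pencil is chosen so that the discriminant has six distinct zeros on it.\<close>

lemma qdisc_pencil:
  fixes s t :: "'a::comm_ring_1"
  shows "qdisc (quartic s t 0 (2 * t) s) = 27 * (32 * (2 * s^2 - t^2)^3 - 675 * s^2 * t^4)"
proof -
  define d where "d = 2 * s^2 - t^2"
  have "invI (quartic s t 0 (2 * t) s) = 6 * d"
    by (simp add: invI_def d_def power2_eq_square algebra_simps)
  moreover have "invJ (quartic s t 0 (2 * t) s) = - 135 * s * t^2"
    by (simp add: invJ_def power2_eq_square algebra_simps)
  moreover have "(t^2)^2 = t^4" by (simp flip: power_mult)
  ultimately show ?thesis
    by (simp add: qdisc_def power_mult_distrib right_diff_distrib flip: d_def)
qed

text \<open>The hypotheses are the sextic of the pencil and its two partial derivatives, up to sign.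
  Eliminating \<open>(2 * s^2 - t^2)^2\<close> gives t^2 = -4 s^2, and substituting back leaves s^4
  = 0.\<close>

lemma qdisc_pencil_nonsingular:
  fixes s t :: complex
  assumes "32 * (2 * s^2 - t^2)^3 - 675 * s^2 * t^4 = 0"
    and "s * (384 * (2 * s^2 - t^2)^2 - 1350 * t^4) = 0"
    and "t * (192 * (2 * s^2 - t^2)^2 + 2700 * s^2 * t^2) = 0"
  shows "s = 0 \<and> t = 0"
proof (rule ccontr)
  assume "\<not> (s = 0 \<and> t = 0)"
  moreover have "t = 0" if "s = 0" using assms(1) that by simp
  moreover have "s = 0" if "t = 0" using assms(2) that by simp
  ultimately have st: "s \<noteq> 0" "t \<noteq> 0" by auto
  have 1: "384 * (2 * s^2 - t^2)^2 = 1350 * (t^2 * t^2)" using assms(2) st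
    by (simp flip: power_add)
  have 2: "192 * (2 * s^2 - t^2)^2 + 2700 * s^2 * t^2 = 0" using assms(3) st by simp
  have "675 * t^2 * (t^2 + 4 * s^2) = 0" using 1 2 by algebra
  then have t: "t^2 = - 4 * s^2" using st by (simp add: eq_neg_iff_add_eq_0)
  have "384 * (6 * s^2)^2 = 1350 * (4 * s^2)^2" using 1 unfolding t by (simp add: power2_eq_square)
  then have "(s^2)^2 = 0" by (simp add: power_mult_distrib)
  then show False using st by simp
qed

text \<open>The equation lives in the coordinates of projective space, so the test pencil of
  quartics is carried there by \<open>cext h\<close> and brought back by
  \<open>cext g\<close>.\<close>

lemma squarefree_qdisc:
  fixes h :: "real^5 \<Rightarrow> real^5"
  assumes hom: "homogeneous d f" and ev: "\<And>v. mpoly_eval f v = qdisc (cext g v)"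
    and inv: "\<And>q. cext g (cext h q) = q"
  shows "squarefree f"
proof (rule squarefree_of_nonsingular_pencil[OF hom])
  let ?u = "cext h (quartic 1 0 0 0 1)" and ?w = "cext h (quartic 0 1 0 2 0)"
  have "s *s ?u + t *s ?w = cext h (quartic s t 0 (2 * t) s)" for s t
  proof -
    have "s *s quartic 1 0 0 0 1 + t *s quartic 0 1 0 2 0 = quartic s t 0 (2 * t) s"
      by (simp add: vec_eq_iff forall_5)
    then show ?thesis by (metis cext_add cext_scale)
  qed
  then have eval: "mpoly_eval f (s *s ?u + t *s ?w) =
      27 * (32 * (2 * s^2 - t^2)^3 - 675 * s^2 * t^4)" for s t
    by (simp add: ev inv qdisc_pencil)
  fix s t
  let ?F = "\<lambda>s t. 27 * (32 * (2 * s^2 - t^2)^3 - 675 * s^2 * t^4) :: complex"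
  assume 0: "mpoly_eval f (s *s ?u + t *s ?w) = 0"
    and ds: "((\<lambda>s. mpoly_eval f (s *s ?u + t *s ?w)) has_field_derivative 0) (at s)"
    and dt: "((\<lambda>t. mpoly_eval f (s *s ?u + t *s ?w)) has_field_derivative 0) (at t)"
  have "((\<lambda>s. ?F s t) has_field_derivative 27 * (s * (384 * (2 * s^2 - t^2)^2 - 1350 * t^4))) (at s)"
    by (auto intro!: derivative_eq_intros simp: algebra_simps)
  moreover have "((\<lambda>t. ?F s t) has_field_derivative
      - 27 * (t * (192 * (2 * s^2 - t^2)^2 + 2700 * s^2 * t^2))) (at t)"
    by (auto intro!: derivative_eq_intros simp: algebra_simps power2_eq_square power3_eq_cube)
  ultimately have "27 * (s * (384 * (2 * s^2 - t^2)^2 - 1350 * t^4)) = 0"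
    "- 27 * (t * (192 * (2 * s^2 - t^2)^2 + 2700 * s^2 * t^2)) = 0"
    using ds dt unfolding eval by (blast intro: DERIV_unique)+
  then show "s = 0 \<and> t = 0"
    using 0 unfolding eval by (intro qdisc_pencil_nonsingular) simp_all
qed

section \<open>Supporting functionals in a chart\<close>

text \<open>The chart has empty interior in the ambient space, so separation is applied to the
  cylinder \<open>D\<close> over \<open>C\<close> in direction \<open>l\<close>. It meets the chart
  exactly in \<open>C\<close>, hence \<open>z\<close> is not interior to it. The result is a linear
  functional rather than an affine one, as projective arguments require.\<close>

lemma supporting_functional_in_chart:
  fixes l z :: "real^'n::finite"
  assumes C: "convex C" "C \<noteq> {}" "C \<subseteq> chart l" and l: "l \<noteq> 0" and z: "z \<in> chart l"
    and nint: "z \<notin> (top_of_set (chart l)) interior_of C"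
  obtains m where "m \<noteq> 0" "m \<bullet> z = 0" "\<And>y. y \<in> C \<Longrightarrow> m \<bullet> y \<ge> 0"
proof -
  define D where "D = (\<Union>x\<in>C. \<Union>y\<in>range (\<lambda>r. r *\<^sub>R l). {x + y})"
  have D: "x + r *\<^sub>R l \<in> D" if "x \<in> C" for x r using that by (auto simp: D_def)
  have CD: "C \<subseteq> D" using D[of _ 0] by auto
  have "convex (range (\<lambda>r. r *\<^sub>R l))"
    by (rule convex_linear_image) (auto intro!: linearI simp: algebra_simps)
  then have convD: "convex D" unfolding D_def using C(1) by (intro convex_sums)
  have znint: "z \<notin> interior D"
  proof
    assume "z \<in> interior D"
    have "interior D \<inter> chart l \<subseteq> C"
    proof
      fix w assume w: "w \<in> interior D \<inter> chart l"
      then have "w \<in> D" using interior_subset by blast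
      then obtain x r where x: "x \<in> C" "w = x + r *\<^sub>R l" by (auto simp: D_def)
      then have "r * (l \<bullet> l) = 0" using C(3) w by (auto simp: chart_def inner_add_right)
      then show "w \<in> C" using x l by simp
    qed
    moreover have "openin (top_of_set (chart l)) (interior D \<inter> chart l)"
      by (metis Int_commute open_interior openin_open_Int)
    ultimately have "interior D \<inter> chart l \<subseteq> (top_of_set (chart l)) interior_of C"
      by (rule interior_of_maximal)
    then show False using nint z \<open>z \<in> interior D\<close> by blast
  qed
  obtain a where a: "a \<noteq> 0" "\<And>x. x \<in> D \<Longrightarrow> a \<bullet> z \<le> a \<bullet> x"
  \<comment> \<open>A degenerate cylinder lies in a hyperplane, whose normal works after a choice of
    sign; otherwise \<open>z\<close> is separated from the interior and the inequality passes to the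
    closure.\<close>
  proof (cases "interior D = {}")
    case True
    then obtain a b where ab: "a \<noteq> 0" "D \<subseteq> {x. a \<bullet> x = b}"
      using empty_interior_subset_hyperplane[OF convD] by metis
    show thesis
    proof (cases "a \<bullet> z \<le> b")
      case True
      then show thesis using ab by (intro that[of a]) auto
    next
      case False
      then show thesis using ab by (intro that[of "- a"]) auto
    qed
  next
    case False
    then obtain a b where ab: "a \<noteq> 0" "a \<bullet> z \<le> b" "\<And>x. x \<in> interior D \<Longrightarrow> b \<le> a \<bullet> x"
      using separating_hyperplane_sets[of "{z}" "interior D"] convD znint
      by (auto simp: convex_interior)
    have "closure (interior D) \<subseteq> {x. a \<bullet> x \<ge> b}"
      by (rule closure_minimal) (use ab in \<open>auto simp: closed_halfspace_ge\<close>)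
    then have "D \<subseteq> {x. a \<bullet> x \<ge> b}"
      using convex_closure_interior[OF convD False] closure_subset by blast
    then show thesis using ab by (intro that[of a]) auto
  qed
  obtain x where x: "x \<in> C" using C(2) by blast
  \<comment> \<open>The cylinder contains a whole line in direction \<open>l\<close>, and
    \<open>a\<close> is bounded below on it.\<close>
  have al: "a \<bullet> l = 0"
  proof (rule ccontr)
    assume nz: "a \<bullet> l \<noteq> 0"
    have "a \<bullet> z \<le> a \<bullet> (x + ((a \<bullet> z - a \<bullet> x - 1) / (a \<bullet> l)) *\<^sub>R l)"
      by (intro a(2) D x)
    then show False using nz by (simp add: inner_add_right)
  qed
  show thesis
  \<comment> \<open>Since \<open>l\<close> equals 1 on the chart, subtracting this multiple of
    \<open>l\<close> moves the bound to 0; the difference is nonzero because \<open>a\<close> is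
    orthogonal to \<open>l\<close>.\<close>
  proof (rule that[of "a - (a \<bullet> z) *\<^sub>R l"])
    show "a - (a \<bullet> z) *\<^sub>R l \<noteq> 0"
    proof
      assume "a - (a \<bullet> z) *\<^sub>R l = 0"
      then have e: "a = (a \<bullet> z) *\<^sub>R l" by simp
      have "(a \<bullet> z) * (l \<bullet> l) = 0" using al by (subst (asm) e) simp
      then have "a \<bullet> z = 0" using l by simp
      then have "a = 0" using e by (metis scaleR_zero_left)
      then show False using a(1) by simp
    qed
    show "(a - (a \<bullet> z) *\<^sub>R l) \<bullet> z = 0"
      using z by (simp add: inner_diff_left chart_def)
    show "(a - (a \<bullet> z) *\<^sub>R l) \<bullet> y \<ge> 0" if "y \<in> C" for y
    proof -
      have "l \<bullet> y = 1" using that C(3) by (auto simp: chart_def)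
      moreover have "a \<bullet> z \<le> a \<bullet> y" using a(2) CD that by blast
      ultimately show ?thesis by (simp add: inner_diff_left)
    qed
  qed
qed

section \<open>Real points of the projected Veronese surface\<close>

definition outer :: "real^'n \<Rightarrow> real^'n \<Rightarrow> real^'n^'n" where
  "outer a b = (\<chi> i j. a $ i * b $ j)"

lemma outer_nth [simp]: "outer a b $ i $ j = a $ i * b $ j"
  by (simp add: outer_def)

lemma outer_mult_vec: "outer a b *v u = (b \<bullet> u) *\<^sub>R a"
  by (simp add: vec_eq_iff matrix_vector_mult_def inner_vec_def sum_distrib_left mult_ac)

text \<open>A vector \<open>u\<close> orthogonal to \<open>a\<close> and \<open>b\<close> is killed
  by the left-hand matrix but not by \<open>A\<close>, so the multiple of \<open>A\<close> is zero;
  and a b^T + b a^T = 0 forces a factor to vanish.\<close>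

lemma outer_sum_in_line:
  fixes A :: "real^3^3"
  assumes "rank A = 3" "outer a b + outer b a \<in> span {A}"
  shows "a = 0 \<or> b = 0"
proof -
  obtain \<mu> where \<mu>: "outer a b + outer b a = \<mu> *\<^sub>R A"
    using assms(2) by (auto simp: span_singleton)
  have "dim {a, b} \<le> card {a, b}" by (rule dim_le_card') simp
  also have "\<dots> \<le> 2" by (simp add: card_insert_if)
  finally have "dim {a, b} < DIM(real^3)" by simp
  then obtain u where u: "u \<noteq> 0" "\<And>y. y \<in> span {a, b} \<Longrightarrow> orthogonal u y"
    using orthogonal_to_subspace_exists by metis
  have "a \<bullet> u = 0" "b \<bullet> u = 0"
    using u(2)[of a] u(2)[of b] by (auto simp: span_base orthogonal_def inner_commute)
  then have "\<mu> *\<^sub>R (A *v u) = 0"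
    using arg_cong[OF \<mu>, of "\<lambda>M. M *v u"]
    by (simp add: matrix_vector_mult_add_rdistrib outer_mult_vec scaleR_matrix_vector_assoc)
  moreover have "A *v u \<noteq> 0"
    using u(1) assms(1) matrix_nonfull_linear_equations_eq[of A] by auto
  ultimately have "\<mu> = 0" by simp
  then have 0: "a $ i * b $ j + b $ i * a $ j = 0" for i j
    using \<mu> by (simp add: vec_eq_iff)
  show ?thesis
  proof (cases "a = 0")
    case False
    then obtain i where i: "a $ i \<noteq> 0" by (auto simp: vec_eq_iff)
    then have "b $ i = 0" using 0[of i i] by simp
    then have "b $ j = 0" for j using 0[of i j] i by simp
    then show ?thesis by (simp add: vec_eq_iff)
  qed simp
qed

lemma pt_scale: "c \<noteq> 0 \<Longrightarrow> pt (c *s v) = pt v"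
proof -
  assume c: "c \<noteq> 0"
  have "k *s v \<in> range (\<lambda>k. k *s (c *s v))" for k
    by (rule range_eqI[of _ _ "k / c"]) (use c in simp)
  then show ?thesis by (auto simp: pt_def)
qed

section \<open>Images of rank-one matrices under the projection\<close>

context
  fixes A :: "real^3^3" and \<pi> :: "real^3^3 \<Rightarrow> real^5"
  assumes proj: "projection_from A \<pi>"
begin

lemma linear_proj: "linear \<pi>"
  using proj by (simp add: projection_from_def)

lemma proj_outer_combination:
  "\<pi> (outer (a *\<^sub>R s + b *\<^sub>R t) (a *\<^sub>R s + b *\<^sub>R t)) =
    a^2 *\<^sub>R \<pi> (outer s s) + (a * b) *\<^sub>R \<pi> (outer s t + outer t s) + b^2 *\<^sub>R \<pi> (outer t t)"
proof -
  have "outer (a *\<^sub>R s + b *\<^sub>R t) (a *\<^sub>R s + b *\<^sub>R t) =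
      a^2 *\<^sub>R outer s s + (a * b) *\<^sub>R (outer s t + outer t s) + b^2 *\<^sub>R outer t t"
    by (simp add: vec_eq_iff power2_eq_square algebra_simps)
  then show ?thesis using linear_proj by (simp add: linear_add linear_scale)
qed

lemma proj_outer_scale: "\<pi> (outer (a *\<^sub>R s) (a *\<^sub>R s)) = a^2 *\<^sub>R \<pi> (outer s s)"
  using proj_outer_combination[of a s 0 0] by simp

text \<open>By polarization the rank-one matrices span all symmetric matrices, and these are mapped
  onto the target.\<close>

lemma proj_squares_span:
  assumes "\<And>t. m \<bullet> \<pi> (outer t t) = 0"
  shows "m = 0"
proof -
  have pol: "m \<bullet> \<pi> (outer s t + outer t s) = 0" for s t
    using assms[of "1 *\<^sub>R s + 1 *\<^sub>R t"] assms[of s] assms[of t]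
    unfolding proj_outer_combination by (simp add: inner_add_right)
  obtain S where S: "transpose S = S" "\<pi> S = m"
    using proj unfolding projection_from_def by (metis (mono_tags, lifting) UNIV_I imageE mem_Collect_eq)
  define e :: "3 \<Rightarrow> real^3" where "e i = axis i 1" for i
  have e: "e i $ j = (if j = i then 1 else 0)" for i j by (simp add: e_def axis_def)
  have sym: "S $ j $ i = S $ i $ j" for i j
    using arg_cong[OF S(1), of "\<lambda>M. M $ i $ j"] by (simp add: transpose_def)
  have "S = S $ 1 $ 1 *\<^sub>R outer (e 1) (e 1) + S $ 2 $ 2 *\<^sub>R outer (e 2) (e 2)
      + S $ 3 $ 3 *\<^sub>R outer (e 3) (e 3) + S $ 1 $ 2 *\<^sub>R (outer (e 1) (e 2) + outer (e 2) (e 1))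
      + S $ 1 $ 3 *\<^sub>R (outer (e 1) (e 3) + outer (e 3) (e 1))
      + S $ 2 $ 3 *\<^sub>R (outer (e 2) (e 3) + outer (e 3) (e 2))" (is "S = ?S")
    using sym[of 1 2] sym[of 1 3] sym[of 2 3] by (simp add: vec_eq_iff forall_3 e)
  then have "m \<bullet> \<pi> S = m \<bullet> \<pi> ?S" by simp
  also have "\<dots> = 0"
    using linear_proj
    by (simp only: linear_add[of \<pi>] linear_scale inner_add_right inner_scaleR_right assms)
      (simp add: pol flip: inner_add_right linear_add)
  finally show ?thesis using S(2) by simp
qed

lemma complexify_scale: "complexify \<pi> (\<chi> i j. c * M $ i $ j) = c *s complexify \<pi> M"
proof -
  let ?R = "\<chi> i j. Re (M $ i $ j)" and ?I = "\<chi> i j. Im (M $ i $ j)"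
  have "(\<chi> i j. Re ((\<chi> i j. c * M $ i $ j) $ i $ j)) = Re c *\<^sub>R ?R - Im c *\<^sub>R ?I"
    "(\<chi> i j. Im ((\<chi> i j. c * M $ i $ j) $ i $ j)) = Re c *\<^sub>R ?I + Im c *\<^sub>R ?R"
    by (simp_all add: vec_eq_iff)
  moreover have "\<pi> (Re c *\<^sub>R ?R - Im c *\<^sub>R ?I) = Re c *\<^sub>R \<pi> ?R - Im c *\<^sub>R \<pi> ?I"
    "\<pi> (Re c *\<^sub>R ?I + Im c *\<^sub>R ?R) = Re c *\<^sub>R \<pi> ?I + Im c *\<^sub>R \<pi> ?R"
    using linear_proj by (simp_all only: linear_add linear_diff linear_scale)
  ultimately show ?thesis
    unfolding complexify_def by (simp only:) (simp add: vec_eq_iff complex_eq_iff)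
qed

lemma complexify_veronese_cvec: "complexify \<pi> (veronese (cvec t)) = cvec (\<pi> (outer t t))"
proof -
  have "(\<chi> i j. Re (veronese (cvec t) $ i $ j)) = outer t t"
    "(\<chi> i j. Im (veronese (cvec t) $ i $ j)) = 0"
    by (simp_all add: veronese_def vec_eq_iff)
  then show ?thesis
    unfolding complexify_def
    by (simp only: linear_0[OF linear_proj]) (simp add: vec_eq_iff complex_eq_iff)
qed

context
  assumes rank: "rank A = 3"
begin

lemma proj_outer_eq_0: "\<pi> (outer a b + outer b a) = 0 \<Longrightarrow> a = 0 \<or> b = 0"
  using proj by (intro outer_sum_in_line[OF rank])
    (auto simp: projection_from_def transpose_def vec_eq_iff mult.commute)

lemma proj_outer_self_nonzero: "t \<noteq> 0 \<Longrightarrow> \<pi> (outer t t) \<noteq> 0"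
  using proj_outer_eq_0[of t t] linear_add[OF linear_proj, of "outer t t" "outer t t"] by force

text \<open>For a complex parameter t = a + i b, reality of the image says that the imaginary part
  \<open>\<pi> (outer a b + outer b a)\<close> is zero, so t is real or purely imaginary. The
  imaginary case only changes a sign, which the normalization by \<open>l\<close> absorbs.\<close>

lemma real_points_in_chart_eq:
  "real_points_in_chart l (projected_veronese \<pi>) =
    {inverse (l \<bullet> \<pi> (outer t t)) *\<^sub>R \<pi> (outer t t) |t. l \<bullet> \<pi> (outer t t) \<noteq> 0}"
proof (intro set_eqI iffI)
  fix y assume "y \<in> real_points_in_chart l (projected_veronese \<pi>)"
  then obtain t0 where y: "l \<bullet> y = 1" "t0 \<noteq> 0" "pt (cvec y) = pt (complexify \<pi> (veronese t0))"
    by (auto simp: real_points_in_chart_def projected_veronese_def chart_def real_pt_eq)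
  have "cvec y \<in> pt (cvec y)" unfolding pt_def by (rule range_eqI[of _ _ 1]) simp
  then obtain c where c: "cvec y = c *s complexify \<pi> (veronese t0)"
    unfolding y(3) by (auto simp: pt_def)
  \<comment> \<open>The Veronese map is quadratic, so a square root of the projective scalar moves
    it into the parameter.\<close>
  define t where "t = csqrt c *s t0"
  define a b where "a = (\<chi> i. Re (t $ i))" and "b = (\<chi> i. Im (t $ i))"
  have "veronese t = (\<chi> i j. c * veronese t0 $ i $ j)"
  proof -
    have "csqrt c * csqrt c = c" using power2_csqrt[of c] by (simp add: power2_eq_square)
    moreover have "csqrt c * x * (csqrt c * z) = (csqrt c * csqrt c) * (x * z)" for x z
      by (simp only: mult_ac)
    ultimately have "csqrt c * x * (csqrt c * z) = c * (x * z)" for x z by simp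
    then show ?thesis by (simp only: veronese_def t_def vector_smult_component vec_lambda_beta)
  qed
  then have cy: "cvec y = complexify \<pi> (veronese t)" by (simp add: c complexify_scale)
  have re: "(\<chi> i j. Re (veronese t $ i $ j)) = outer a a - outer b b"
    and im: "(\<chi> i j. Im (veronese t $ i $ j)) = outer a b + outer b a"
    by (simp_all add: veronese_def vec_eq_iff a_def b_def)
  have "y $ k = \<pi> (outer a a - outer b b) $ k \<and> 0 = \<pi> (outer a b + outer b a) $ k" for k
    using arg_cong[OF cy, of "\<lambda>v. v $ k"] unfolding complexify_def re im
    by (simp add: complex_eq_iff)
  then have yk: "y = \<pi> (outer a a - outer b b)" and "\<pi> (outer a b + outer b a) = 0"
    by (simp_all add: vec_eq_iff)
  then consider "a = 0" | "b = 0" using proj_outer_eq_0 by blast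
  then show "y \<in> {inverse (l \<bullet> \<pi> (outer t t)) *\<^sub>R \<pi> (outer t t) |t. l \<bullet> \<pi> (outer t t) \<noteq> 0}"
  proof cases
    case 1
    then have "outer a a - outer b b = - outer b b" by (simp add: vec_eq_iff)
    then have "y = - \<pi> (outer b b)" using yk linear_proj by (simp add: linear_neg)
    moreover from this have "l \<bullet> \<pi> (outer b b) = - 1" using y(1) by simp
    ultimately show ?thesis by (intro CollectI exI[of _ b]) simp
  next
    case 2
    then have "outer a a - outer b b = outer a a" by (simp add: vec_eq_iff)
    then have "y = \<pi> (outer a a)" using yk by simp
    then show ?thesis using y(1) by (intro CollectI exI[of _ a]) simp
  qed
next
  fix y assume "y \<in> {inverse (l \<bullet> \<pi> (outer t t)) *\<^sub>R \<pi> (outer t t) |t. l \<bullet> \<pi> (outer t t) \<noteq> 0}"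
  then obtain t where t: "l \<bullet> \<pi> (outer t t) \<noteq> 0"
    "y = inverse (l \<bullet> \<pi> (outer t t)) *\<^sub>R \<pi> (outer t t)" by auto
  have "outer 0 0 = (0 :: real^3^3)" by (simp add: vec_eq_iff)
  then have "t \<noteq> 0" using t(1) linear_0[OF linear_proj] by auto
  moreover have "real_pt y = pt (complexify \<pi> (veronese (cvec t)))"
    using t by (simp add: real_pt_eq cvec_scaleR pt_scale complexify_veronese_cvec)
  ultimately have "real_pt y \<in> projected_veronese \<pi>"
    unfolding projected_veronese_def by (intro CollectI exI[of _ "cvec t"]) simp
  moreover have "y \<in> chart l" using t by (simp add: chart_def)
  ultimately show "y \<in> real_points_in_chart l (projected_veronese \<pi>)"
    by (simp add: real_points_in_chart_def)
qed

end

end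

section \<open>Eigenvector decomposition read off from the signature\<close>

lemma symmetric_inner:
  fixes A :: "real^'n^'n"
  assumes "transpose A = A"
  shows "(A *v v) \<bullet> w = v \<bullet> (A *v w)"
  by (metis assms dot_lmul_matrix transpose_matrix_vector)

lemma eigenvectors_orthogonal:
  fixes A :: "real^'n^'n"
  assumes "transpose A = A" "A *v v = k *\<^sub>R v" "A *v w = l *\<^sub>R w" "k \<noteq> l"
  shows "orthogonal v w"
proof -
  have "k * (v \<bullet> w) = l * (v \<bullet> w)"
    using symmetric_inner[OF assms(1), of v w] assms(2,3) by simp
  then show ?thesis using assms(4) by (simp add: orthogonal_def)
qed

lemma subspace_eigenspace: "subspace (eigenspace A l)"
  unfolding eigenspace_def
  by (auto simp: subspace_def matrix_vector_right_distrib matrix_vector_mult_scaleR algebra_simps)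

lemma orthonormal_eigenvectors:
  fixes A :: "real^'n^'n"
  assumes sym: "transpose A = A"
  shows "\<exists>B. finite B \<and> card B = (\<Sum>l\<in>S. dim (eigenspace A l)) \<and> pairwise orthogonal B \<and>
    (\<forall>v\<in>B. norm v = 1 \<and> (\<exists>l\<in>S. A *v v = l *\<^sub>R v))"
proof (cases "finite S")
  \<comment> \<open>A sum over an infinite index set is 0 by convention, so the empty set has the
    right cardinality.\<close>
  case False
  then show ?thesis by (intro exI[of _ "{}"]) simp
next
  case True
  have "\<exists>B. B \<subseteq> eigenspace A l \<and> pairwise orthogonal B \<and> (\<forall>v\<in>B. norm v = 1) \<and>
      finite B \<and> card B = dim (eigenspace A l)" for l
    using orthonormal_basis_subspace[OF subspace_eigenspace[of A l]]
    by (metis independent_imp_finite)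
  then obtain B where B: "\<And>l. B l \<subseteq> eigenspace A l" "\<And>l. pairwise orthogonal (B l)"
    "\<And>l v. v \<in> B l \<Longrightarrow> norm v = 1" "\<And>l. finite (B l)" "\<And>l. card (B l) = dim (eigenspace A l)"
    by metis
  have orth: "orthogonal v w" if "v \<in> B k" "w \<in> B l" "k \<noteq> l" for k l v w
    by (rule eigenvectors_orthogonal[OF sym _ _ that(3)])
      (use that B(1) in \<open>auto simp: eigenspace_def\<close>)
  have disj: "B k \<inter> B l = {}" if "k \<noteq> l" for k l
  proof -
    have "norm v = 0" if "v \<in> B k" "v \<in> B l" for v
      using orth[OF that \<open>k \<noteq> l\<close>] by (simp add: orthogonal_self)
    then show ?thesis using B(3)[of _ k] by fastforce
  qed
  show ?thesis
  proof (intro exI[of _ "\<Union>l\<in>S. B l"] conjI ballI)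
    show "finite (\<Union>l\<in>S. B l)" using True B(4) by blast
    show "card (\<Union>l\<in>S. B l) = (\<Sum>l\<in>S. dim (eigenspace A l))"
      by (subst card_UN_disjoint) (use True B(4,5) disj in auto)
    show "pairwise orthogonal (\<Union>l\<in>S. B l)"
    proof (rule pairwiseI)
      fix v w assume "v \<in> (\<Union>l\<in>S. B l)" "w \<in> (\<Union>l\<in>S. B l)" "v \<noteq> w"
      then obtain k l where "v \<in> B k" "w \<in> B l" by blast
      then show "orthogonal v w"
        using orth[of v k w l] B(2)[of k] \<open>v \<noteq> w\<close> by (cases "k = l") (auto simp: pairwise_def)
    qed
    fix v assume "v \<in> (\<Union>l\<in>S. B l)"
    then obtain l where l: "l \<in> S" "v \<in> B l" by blast
    show "norm v = 1" by (rule B(3)[OF l(2)])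
    show "\<exists>l\<in>S. A *v v = l *\<^sub>R v"
      using l B(1)[of l] by (auto simp: eigenspace_def)
  qed
qed

text \<open>By counting: orthonormal eigenvectors for positive and for negative eigenvalues are
  \<open>p + n\<close> in number, hence a basis. The two sides of the spectral formula then agree on
  that basis.\<close>

lemma signature_decomposition:
  fixes A :: "real^'n^'n"
  assumes sym: "transpose A = A" and sig: "signature A = (p, n)" and pn: "p + n = CARD('n)"
  obtains P N \<mu> where "finite P" "finite N" "card P = p" "card N = n" "P \<inter> N = {}"
    "\<forall>v\<in>P. \<mu> v > 0" "\<forall>v\<in>N. \<mu> v < 0" "span (P \<union> N) = UNIV"
    "A = (\<Sum>v\<in>P \<union> N. \<mu> v *\<^sub>R outer v v)"
proof -
  obtain P where P: "finite P" "card P = (\<Sum>l\<in>{l. l > 0 \<and> eigenvalue A l}. dim (eigenspace A l))" "pairwise orthogonal P"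
    "\<And>v. v \<in> P \<Longrightarrow> norm v = 1 \<and> (\<exists>l\<in>{l. l > 0 \<and> eigenvalue A l}. A *v v = l *\<^sub>R v)"
    using orthonormal_eigenvectors[OF sym] by meson
  obtain N where N: "finite N" "card N = (\<Sum>l\<in>{l. l < 0 \<and> eigenvalue A l}. dim (eigenspace A l))" "pairwise orthogonal N"
    "\<And>v. v \<in> N \<Longrightarrow> norm v = 1 \<and> (\<exists>l\<in>{l. l < 0 \<and> eigenvalue A l}. A *v v = l *\<^sub>R v)"
    using orthonormal_eigenvectors[OF sym] by meson
  have cards: "card P = p" "card N = n" using P(2) N(2) sig by (simp_all add: signature_def)
  have PN: "orthogonal v w" if vw: "v \<in> P" "w \<in> N" for v w
  proof -
    obtain k where "k > 0" "A *v v = k *\<^sub>R v" using P(4)[OF vw(1)] by auto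
    moreover obtain l where "l < 0" "A *v w = l *\<^sub>R w" using N(4)[OF vw(2)] by auto
    ultimately show ?thesis using eigenvectors_orthogonal[OF sym, of v k w l] by simp
  qed
  have NP: "orthogonal w v" if "v \<in> P" "w \<in> N" for v w
    using PN[OF that] by (simp add: orthogonal_commute)
  have disj: "P \<inter> N = {}"
  proof -
    have "norm v = 0" if "v \<in> P" "v \<in> N" for v
      using PN[OF that] by (simp add: orthogonal_self)
    then show ?thesis using P(4) by fastforce
  qed
  let ?B = "P \<union> N"
  have norm: "v \<bullet> v = 1" if "v \<in> ?B" for v
    using that P(4) N(4) by (auto simp: norm_eq_1)
  have orth: "pairwise orthogonal ?B"
    using P(3) N(3) PN NP by (auto simp: pairwise_def)
  have "0 \<notin> ?B" using norm[of 0] by auto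
  then have indep: "independent ?B" by (rule pairwise_orthogonal_independent[OF orth])
  have card: "card ?B = CARD('n)" using P(1) N(1) disj pn cards by (simp add: card_Un_disjoint)
  have span: "span ?B = UNIV"
    using card_eq_dim[of ?B UNIV] card P(1) N(1) indep by (auto simp: dim_UNIV)
  define \<mu> where "\<mu> v = v \<bullet> (A *v v)" for v
  have eig: "A *v v = \<mu> v *\<^sub>R v" if v: "v \<in> ?B" for v
  proof -
    obtain l where l: "A *v v = l *\<^sub>R v" using v P(4)[of v] N(4)[of v] by auto
    then show ?thesis using norm[OF v] by (simp add: \<mu>_def)
  qed
  have pos: "\<mu> v > 0" if "v \<in> P" for v
    using P(4)[OF that] norm[of v] that by (auto simp: \<mu>_def)
  have neg: "\<mu> v < 0" if "v \<in> N" for v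
    using N(4)[OF that] norm[of v] that by (auto simp: \<mu>_def)
  define A' where "A' = (\<Sum>v\<in>?B. \<mu> v *\<^sub>R outer v v)"
  have A': "A' *v x = (\<Sum>v\<in>?B. (\<mu> v * (v \<bullet> x)) *\<^sub>R v)" for x
  proof -
    have "(\<Sum>v\<in>S. \<mu> v *\<^sub>R outer v v) *v x = (\<Sum>v\<in>S. (\<mu> v * (v \<bullet> x)) *\<^sub>R v)" for S
      by (induction S rule: infinite_finite_induct)
        (auto simp: matrix_vector_mult_add_rdistrib scaleR_matrix_vector_assoc[symmetric] outer_mult_vec)
    then show ?thesis by (simp add: A'_def)
  qed
  have "A *v w = A' *v w" if w: "w \<in> ?B" for w
  proof -
    have "A' *v w = (\<Sum>v\<in>?B. if v = w then \<mu> w *\<^sub>R w else 0)"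
      unfolding A'
    proof (rule sum.cong[OF refl])
      fix v assume "v \<in> ?B"
      then show "(\<mu> v * (v \<bullet> w)) *\<^sub>R v = (if v = w then \<mu> w *\<^sub>R w else 0)"
        using orth w norm by (auto simp: pairwise_def orthogonal_def)
    qed
    then show ?thesis using w P(1) N(1) eig[OF w] by (simp add: sum.delta)
  qed
  then have "A *v x = A' *v x" for x
    using linear_eq_on[OF matrix_vector_mul_linear matrix_vector_mul_linear, of x ?B A A'] span
    by simp
  then have "A = A'" by (simp add: matrix_eq)
  then show thesis
    using that[of P N \<mu>] P(1) N(1) cards disj pos neg span by (simp add: A'_def)
qed

section \<open>Real quadratic forms\<close>

text \<open>Leading and constant coefficient of opposite sign give the second factor two simple real
  roots. The first factor must vanish at both, so by Vieta each constant term is the leading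
  coefficient times the same product of roots.\<close>

lemma quadratics_same_sign_imp_proportional:
  fixes a b c \<alpha> \<beta> \<gamma> :: real
  assumes "\<alpha> > 0" "\<gamma> < 0"
    and nonneg: "\<And>x. (a * x^2 + b * x + c) * (\<alpha> * x^2 + \<beta> * x + \<gamma>) \<ge> 0"
  shows "c * \<alpha> = a * \<gamma>"
proof -
  have "\<alpha> * \<gamma> < 0" using assms(1,2) by (rule mult_pos_neg)
  then have "discrim \<alpha> \<beta> \<gamma> > 0"
    using zero_le_power2[of \<beta>] unfolding discrim_def mult.assoc by linarith
  then obtain x1 x2 where x: "x1 \<noteq> x2"
    "\<alpha> * x1^2 + \<beta> * x1 + \<gamma> = 0" "\<alpha> * x2^2 + \<beta> * x2 + \<gamma> = 0"
    using discriminant_pos_ex[of \<alpha> \<beta> \<gamma>] assms(1) by auto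
  have "(x1 - x2) * (\<alpha> * (x1 + x2) + \<beta>) = 0"
    using x(2,3) by (simp add: power2_eq_square algebra_simps)
  then have \<beta>: "\<beta> = - \<alpha> * (x1 + x2)" using x(1) by simp
  have "\<gamma> = - (\<alpha> * x1^2) - \<beta> * x1" using x(2) by linarith
  then have \<gamma>: "\<gamma> = \<alpha> * (x1 * x2)" unfolding \<beta> by (simp add: power2_eq_square algebra_simps)
  \<comment> \<open>The product has a minimum at each root of the second factor, so its derivative vanishes there.\<close>
  have root: "a * x^2 + b * x + c = 0"
    if r: "\<alpha> * x^2 + \<beta> * x + \<gamma> = 0" and d: "2 * \<alpha> * x + \<beta> \<noteq> 0" for x
  proof -
    have "((\<lambda>x. (a * x^2 + b * x + c) * (\<alpha> * x^2 + \<beta> * x + \<gamma>)) has_real_derivative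
        (a * x^2 + b * x + c) * (2 * \<alpha> * x + \<beta>)) (at x)"
      by (rule derivative_eq_intros refl | simp add: r)+
    moreover have "\<forall>y. \<bar>x - y\<bar> < 1 \<longrightarrow> (a * x^2 + b * x + c) * (\<alpha> * x^2 + \<beta> * x + \<gamma>) \<le>
        (a * y^2 + b * y + c) * (\<alpha> * y^2 + \<beta> * y + \<gamma>)"
      using nonneg by (simp add: r)
    ultimately have "(a * x^2 + b * x + c) * (2 * \<alpha> * x + \<beta>) = 0"
      using DERIV_local_min zero_less_one by blast
    then show ?thesis using d by simp
  qed
  have "2 * \<alpha> * x1 + \<beta> = \<alpha> * (x1 - x2)" "2 * \<alpha> * x2 + \<beta> = \<alpha> * (x2 - x1)"
    unfolding \<beta> by (simp_all add: algebra_simps)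
  then have r1: "a * x1^2 + b * x1 + c = 0" and r2: "a * x2^2 + b * x2 + c = 0"
    using root x assms(1) by auto
  then have "(x1 - x2) * (a * (x1 + x2) + b) = 0"
    by (simp add: power2_eq_square algebra_simps)
  then have b: "b = - a * (x1 + x2)" using x(1) by simp
  have "c = - (a * x1^2) - b * x1" using r1 by linarith
  then have "c = a * (x1 * x2)" unfolding b by (simp add: power2_eq_square algebra_simps)
  then show ?thesis by (simp add: \<gamma>)
qed

text \<open>\<open>Lp\<close> is the polar form without the factor 1/2, so \<open>Lp s s\<close> is
  twice \<open>L s\<close>. A single identity is enough to instantiate both the forms on matrices
  and the Hankel form of a functional on quartics.\<close>

locale real_quadratic_form =
  fixes L :: "'a::real_vector \<Rightarrow> real" and Lp :: "'a \<Rightarrow> 'a \<Rightarrow> real"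
  assumes expand: "L (a *\<^sub>R s + b *\<^sub>R t) = a^2 * L s + (a * b) * Lp s t + b^2 * L t"
begin

lemma scale: "L (a *\<^sub>R s) = a^2 * L s"
  using expand[of a s 0 0] by simp

lemma line: "L (x *\<^sub>R u + v) = L u * x^2 + Lp u v * x + L v"
  using expand[of x u 1 v] by simp

lemma polar_eq_0:
  assumes nonneg: "\<And>t. L t \<ge> 0" and "L v = 0"
  shows "Lp v w = 0"
proof (rule ccontr)
  assume nz: "Lp v w \<noteq> 0"
  \<comment> \<open>Along \<open>x v + w\<close> the form is affine in x, and this x brings it to
    -1.\<close>
  have "L ((- (L w + 1) / Lp v w) *\<^sub>R v + w) = - 1"
    unfolding line using nz assms(2) by simp
  then show False using nonneg[of "(- (L w + 1) / Lp v w) *\<^sub>R v + w"] by linarith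
qed

lemma subspace_zeros:
  assumes nonneg: "\<And>t. L t \<ge> 0"
  shows "subspace {t. L t = 0}"
proof (rule subspaceI)
  show "0 \<in> {t. L t = 0}" using scale[of 0 0] by simp
  show "x + y \<in> {t. L t = 0}" if "x \<in> {t. L t = 0}" "y \<in> {t. L t = 0}" for x y
    using that polar_eq_0[OF nonneg] expand[of 1 x 1 y] by simp
  show "c *\<^sub>R x \<in> {t. L t = 0}" if "x \<in> {t. L t = 0}" for c x
    using that by (simp add: scale)
qed

lemma isotropic_between:
  assumes "L u > 0" "L v < 0"
  obtains t where "t \<noteq> 0" "L t = 0"
proof -
  have "L u * L v < 0" using assms by (rule mult_pos_neg)
  then have "discrim (L u) (Lp u v) (L v) > 0"
    using zero_le_power2[of "Lp u v"] unfolding discrim_def mult.assoc by linarith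
  then obtain x where x: "L u * x^2 + Lp u v * x + L v = 0"
    using discriminant_pos_ex[of "L u" "Lp u v" "L v"] assms(1) by auto
  show thesis
  proof (rule that[of "x *\<^sub>R u + v"])
    show "L (x *\<^sub>R u + v) = 0" using x by (simp add: line)
    show "x *\<^sub>R u + v \<noteq> 0"
    proof
      assume "x *\<^sub>R u + v = 0"
      then have "v = (- x) *\<^sub>R u" by (simp add: eq_neg_iff_add_eq_0 add.commute)
      then have "L v = x^2 * L u" using scale[of "- x" u] by simp
      then have "L v \<ge> 0" using assms(1) by simp
      then show False using assms(2) by simp
    qed
  qed
qed

end

text \<open>On planes spanned by a positive and a negative vector the comparison of quadratics
  applies, which settles every \<open>t\<close> with \<open>L t \<noteq> 0\<close>. Isotropic
  vectors are reached by perturbing with \<open>u\<close>.\<close>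

lemma same_sign_forms_proportional:
  assumes L: "real_quadratic_form L Lp" and M: "real_quadratic_form M Mp"
    and nonneg: "\<And>t. M t * L t \<ge> 0" and u: "L u > 0" and v: "L v < 0"
  obtains c where "\<And>t. M t = c * L t"
proof -
  interpret L: real_quadratic_form L Lp by (rule L)
  interpret M: real_quadratic_form M Mp by (rule M)
  have uv: "M v * L u = M u * L v" if "L u > 0" "L v < 0" for u v
  proof (rule quadratics_same_sign_imp_proportional[OF that])
    show "(M u * x^2 + Mp u v * x + M v) * (L u * x^2 + Lp u v * x + L v) \<ge> 0" for x
      using nonneg[of "x *\<^sub>R u + v"] by (simp add: L.line M.line)
  qed
  define c where "c = M v / L v"
  have nz: "M t = c * L t" if "L t \<noteq> 0" for t
  proof (cases "L t > 0")
    case True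
    then show ?thesis using uv[OF True v] v by (simp add: c_def field_simps)
  next
    case False
    then have "L t < 0" using that by simp
    then have t: "M t = M u / L u * L t" using uv[OF u, of t] u by (simp add: field_simps)
    have "c = M u / L u" using uv[OF u v] u v by (simp add: c_def field_simps)
    then show ?thesis using t by simp
  qed
  have "M t = c * L t" if 0: "L t = 0" for t
  proof -
    \<comment> \<open>For x beyond this bound, x u + t is not isotropic. The resulting identity is
      affine in x, and its validity at p and 2p forces its constant term \<open>M t\<close> to
      vanish.\<close>
    define p where "p = \<bar>Lp u t / L u\<bar> + 1"
    have p: "p > 0" unfolding p_def using abs_ge_zero[of "Lp u t / L u"] by linarith
    have *: "M t + x * (Mp u t - c * Lp u t) = 0" if x: "x \<ge> p" for x
    proof -
      have "x + Lp u t / L u > 0" using x unfolding p_def by linarith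
      moreover have "L (x *\<^sub>R u + t) = x * L u * (x + Lp u t / L u)"
        unfolding L.line using u by (simp add: 0 power2_eq_square distrib_left)
      ultimately have "L (x *\<^sub>R u + t) \<noteq> 0" using u x p by simp
      then have "M (x *\<^sub>R u + t) = c * L (x *\<^sub>R u + t)" by (rule nz)
      then have "M u * x^2 + Mp u t * x + M t = c * (L u * x^2 + Lp u t * x)"
        by (simp only: L.line M.line 0 add_0_right)
      then show ?thesis using nz[of u] u by (simp add: algebra_simps)
    qed
    have "M t = 0" using *[of p] *[of "2 * p"] p by simp
    then show ?thesis by (simp add: 0)
  qed
  then show thesis using nz that by metis
qed

section \<open>The boundary of the cone of nonnegative quartics\<close>

text \<open>A convex combination of nonnegative values is 0 only if every point of positive weight
  has value 0.\<close>

lemma convex_hull_supporting_face: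
  fixes m :: "'a::real_inner"
  assumes "y \<in> convex hull X" "m \<bullet> y = 0" "\<And>x. x \<in> X \<Longrightarrow> m \<bullet> x \<ge> 0"
  shows "y \<in> convex hull {x\<in>X. m \<bullet> x = 0}"
proof -
  obtain S u where S: "finite S" "S \<subseteq> X" "\<And>x. x \<in> S \<Longrightarrow> 0 \<le> u x" "sum u S = 1"
    "(\<Sum>x\<in>S. u x *\<^sub>R x) = y"
    using assms(1) unfolding convex_hull_explicit by blast
  have "(\<Sum>x\<in>S. u x * (m \<bullet> x)) = 0"
    using assms(2) by (simp flip: S(5) add: inner_sum_right)
  then have 0: "u x * (m \<bullet> x) = 0" if "x \<in> S" for x
    using that S(1-3) assms(3) by (subst (asm) sum_nonneg_eq_0_iff) auto
  let ?S = "{x\<in>S. u x \<noteq> 0}"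
  have "sum u ?S = 1"
    unfolding S(4)[symmetric] by (rule sum.mono_neutral_left) (use S(1) in auto)
  moreover have "(\<Sum>x\<in>?S. u x *\<^sub>R x) = y"
    unfolding S(5)[symmetric] by (rule sum.mono_neutral_left) (use S(1) in auto)
  moreover have "?S \<subseteq> {x\<in>X. m \<bullet> x = 0}" using 0 S(2) by auto
  moreover have "finite ?S" "\<forall>x\<in>?S. 0 \<le> u x" using S by auto
  ultimately show ?thesis unfolding convex_hull_explicit by blast
qed

lemma qsq_scale: "qsq (k * s0) (k * s1) (k * s2) = (k^2) *\<^sub>R qsq s0 s1 (s2 :: real)"
  by (simp add: vec_eq_iff forall_5 qsq_def power2_eq_square algebra_simps)

lemma parallel_imp_multiple:
  fixes s0 s1 s2 t0 t1 t2 :: real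
  assumes "s1 * t2 = s2 * t1" "s2 * t0 = s0 * t2" "s0 * t1 = s1 * t0" "\<not> (s0 = 0 \<and> s1 = 0 \<and> s2 = 0)"
  obtains k where "t0 = k * s0" "t1 = k * s1" "t2 = k * s2"
proof -
  consider "s0 \<noteq> 0" | "s1 \<noteq> 0" | "s2 \<noteq> 0" using assms(4) by blast
  then show thesis
  proof cases
    case 1
    then show thesis using that[of "t0 / s0"] assms(1-3) by (simp add: field_simps)
  next
    case 2
    then show thesis using that[of "t1 / s1"] assms(1-3) by (simp add: field_simps)
  next
    case 3
    then show thesis using that[of "t2 / s2"] assms(1-3) by (simp add: field_simps)
  qed
qed

text \<open>A vector orthogonal to s and t is parallel to their cross product; the conclusions are
  the components of the vanishing product of r with s x t.\<close>

lemma parallel_to_cross: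
  fixes r0 r1 r2 s0 s1 s2 t0 t1 t2 :: real
  assumes "r0 * s0 + r1 * s1 + r2 * s2 = 0" "r0 * t0 + r1 * t1 + r2 * t2 = 0"
  shows "r0 * (s2 * t0 - s0 * t2) = r1 * (s1 * t2 - s2 * t1)"
    "r1 * (s0 * t1 - s1 * t0) = r2 * (s2 * t0 - s0 * t2)"
    "r2 * (s1 * t2 - s2 * t1) = r0 * (s0 * t1 - s1 * t0)"
  using assms by algebra+

lemma parallel_rows_minors:
  fixes n0 n1 n2 :: real
  assumes "r0 * n1 = r1 * n0" "r1 * n2 = r2 * n1" "r2 * n0 = r0 * n2"
    and "q0 * n1 = q1 * n0" "q1 * n2 = q2 * n1" "q2 * n0 = q0 * n2"
    and "\<not> (n0 = 0 \<and> n1 = 0 \<and> n2 = 0)"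
  shows "r0 * q1 = r1 * q0" "r1 * q2 = r2 * q1"
proof -
  obtain k where k: "r0 = k * n0" "r1 = k * n1" "r2 = k * n2"
    using parallel_imp_multiple[of n1 r2 n2 r1 r0 n0] assms by (metis mult.commute)
  obtain j where j: "q0 = j * n0" "q1 = j * n1" "q2 = j * n2"
    using parallel_imp_multiple[of n1 q2 n2 q1 q0 n0] assms by (metis mult.commute)
  show "r0 * q1 = r1 * q0" "r1 * q2 = r2 * q1" by (simp_all add: k j)
qed

text \<open>\<open>\<kappa>\<close> identifies quartics with the homogeneous coordinates of
  projective 4-space, with inverse \<open>g\<close>. A negative definite \<open>l\<close> is covered
  by changing the sign of both maps.\<close>

locale positive_quartic_chart =
  fixes \<kappa> g :: "real^5 \<Rightarrow> real^5" and l :: "real^5"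
  assumes lin: "linear \<kappa>" "linear g" and inv: "\<And>q. g (\<kappa> q) = q" "\<And>y. \<kappa> (g y) = y"
    and pos: "\<And>s0 s1 s2. \<not> (s0 = 0 \<and> s1 = 0 \<and> s2 = 0) \<Longrightarrow> l \<bullet> \<kappa> (qsq s0 s1 s2) > 0"
begin

definition normalize :: "real^5 \<Rightarrow> real^5" where
  "normalize q = inverse (l \<bullet> \<kappa> q) *\<^sub>R \<kappa> q"

definition squares :: "(real^5) set" where
  "squares = {normalize (qsq s0 s1 s2) |s0 s1 s2. \<not> (s0 = 0 \<and> s1 = 0 \<and> s2 = 0)}"

lemma l_nonzero: "l \<noteq> 0"
  using pos[of 1 0 0] by auto

lemma normalize_in_chart: "l \<bullet> \<kappa> q > 0 \<Longrightarrow> normalize q \<in> chart l"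
  by (simp add: normalize_def chart_def)

lemma normalize_scale: "k \<noteq> 0 \<Longrightarrow> normalize (k *\<^sub>R q) = normalize q"
  by (simp add: normalize_def linear_scale[OF lin(1)])

lemma squares_in_chart: "squares \<subseteq> chart l"
  using normalize_in_chart pos by (auto simp: squares_def)

lemma hull_in_chart: "convex hull squares \<subseteq> chart l"
  by (rule hull_minimal[OF squares_in_chart]) (simp add: chart_def convex_hyperplane)

text \<open>The pulled-back supporting functional \<open>\<mu>\<close> gives a nonnegative form M on
  quadratics with Hankel matrix (\<mu>1 \<mu>2 \<mu>3; \<mu>2 \<mu>3 \<mu>4; \<mu>3 \<mu>4 \<mu>5),
  and squares on the supported face come from its kernel. A face with one square leaves y equal to
  that square; two different squares make the kernel at least 2-dimensional and force a common
  double root.\<close>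

lemma qdisc_frontier:
  assumes compact: "compact squares"
    and y: "y \<in> (top_of_set (chart l)) frontier_of (convex hull squares)"
  shows "qdisc (g y) = 0"
proof -
  let ?C = "convex hull squares"
  have "closed ?C" using compact_convex_hull[OF compact] by (rule compact_imp_closed)
  then have "(top_of_set (chart l)) closure_of ?C = ?C"
    using hull_in_chart by (simp add: closure_of_closedin closed_subset)
  then have yC: "y \<in> ?C" "y \<notin> (top_of_set (chart l)) interior_of ?C"
    using y by (auto simp: frontier_of_def)
  obtain m where m: "m \<noteq> 0" "m \<bullet> y = 0" "\<And>x. x \<in> ?C \<Longrightarrow> m \<bullet> x \<ge> 0"
    by (rule supporting_functional_in_chart[OF _ _ hull_in_chart l_nonzero _ yC(2)])
      (use yC(1) hull_in_chart in auto)
  define F where "F = {x\<in>squares. m \<bullet> x = 0}"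
  have yF: "y \<in> convex hull F"
    unfolding F_def by (rule convex_hull_supporting_face[OF yC(1) m(2)]) (simp add: m(3) hull_inc)
  define \<mu> where "\<mu> = adjoint \<kappa> m"
  have \<mu>: "m \<bullet> \<kappa> q = \<mu> \<bullet> q" for q
    unfolding \<mu>_def using adjoint_works[OF lin(1)] by (simp add: inner_commute)
  have "\<mu> \<noteq> 0"
  proof
    assume "\<mu> = 0"
    then have "m \<bullet> m = 0" using \<mu>[of "g m"] by (simp add: inv)
    then show False using m(1) by simp
  qed
  define M where "M s = \<mu> \<bullet> qsq (s $ 1) (s $ 2) (s $ 3)" for s :: "real^3"
  define Mp where "Mp s t = 2 * (\<mu> $ 1 * (s $ 1 * t $ 1) + \<mu> $ 2 * (s $ 1 * t $ 2 + s $ 2 * t $ 1)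
      + \<mu> $ 3 * (s $ 1 * t $ 3 + s $ 2 * t $ 2 + s $ 3 * t $ 1)
      + \<mu> $ 4 * (s $ 2 * t $ 3 + s $ 3 * t $ 2) + \<mu> $ 5 * (s $ 3 * t $ 3))" for s t :: "real^3"
  interpret M: real_quadratic_form M Mp
    by unfold_locales
      (simp add: M_def Mp_def qsq_def inner_vec_def sum_5 power2_eq_square algebra_simps)
  have Mnonneg: "M s \<ge> 0" for s
  proof (cases "s $ 1 = 0 \<and> s $ 2 = 0 \<and> s $ 3 = 0")
    case True
    then show ?thesis by (simp add: M_def qsq_def inner_vec_def sum_5)
  next
    case False
    let ?q = "qsq (s $ 1) (s $ 2) (s $ 3)"
    have "normalize ?q \<in> ?C" using False by (intro hull_inc) (auto simp: squares_def)
    then have "inverse (l \<bullet> \<kappa> ?q) * M s \<ge> 0" using m(3) by (fastforce simp: normalize_def \<mu> M_def)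
    then show ?thesis using pos[OF False] by (simp add: zero_le_mult_iff)
  qed
  have ker: "\<mu> $ 1 * s0 + \<mu> $ 2 * s1 + \<mu> $ 3 * s2 = 0 \<and> \<mu> $ 2 * s0 + \<mu> $ 3 * s1 + \<mu> $ 4 * s2 = 0 \<and>
      \<mu> $ 3 * s0 + \<mu> $ 4 * s1 + \<mu> $ 5 * s2 = 0"
    if "normalize (qsq s0 s1 s2) \<in> F" "\<not> (s0 = 0 \<and> s1 = 0 \<and> s2 = 0)" for s0 s1 s2
  proof -
    have "\<mu> \<bullet> qsq s0 s1 s2 = 0"
      using that(1) pos[OF that(2)] by (simp add: F_def normalize_def \<mu>)
    then have "M (vector [s0, s1, s2]) = 0" by (simp add: M_def)
    then have "Mp (vector [s0, s1, s2]) w = 0" for w by (rule M.polar_eq_0[OF Mnonneg])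
    from this[of "axis 1 1"] this[of "axis 2 1"] this[of "axis 3 1"] show ?thesis
      by (simp add: Mp_def axis_def algebra_simps)
  qed
  show ?thesis
  proof (cases "\<exists>x. F \<subseteq> {x}")
    case True
    then obtain x where "F = {x}" using yF by (metis convex_hull_empty empty_iff subset_singletonD)
    then have "y \<in> squares" using yF by (auto simp: F_def)
    then obtain s0 s1 s2 where "y = normalize (qsq s0 s1 s2)" by (auto simp: squares_def)
    then have "g y = inverse (l \<bullet> \<kappa> (qsq s0 s1 s2)) *s qsq s0 s1 s2"
      by (simp add: normalize_def linear_scale[OF lin(2)] inv scalar_mult_eq_scaleR)
    then show ?thesis by (simp only: qdisc_scaled_square)
  next
    case False
    then obtain x x' where xx: "x \<in> F" "x' \<in> F" "x \<noteq> x'" by blast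
    then obtain s0 s1 s2 t0 t1 t2 where
      s: "x = normalize (qsq s0 s1 s2)" "\<not> (s0 = 0 \<and> s1 = 0 \<and> s2 = 0)" and
      t: "x' = normalize (qsq t0 t1 t2)" "\<not> (t0 = 0 \<and> t1 = 0 \<and> t2 = 0)"
      unfolding F_def squares_def by blast
    \<comment> \<open>The cross product of the two kernel vectors: every row of the Hankel matrix is
      a multiple of it, so the 2 by 2 minors vanish.\<close>
    define n0 n1 n2 where n: "n0 = s1 * t2 - s2 * t1" "n1 = s2 * t0 - s0 * t2" "n2 = s0 * t1 - s1 * t0"
    have n_nz: "\<not> (n0 = 0 \<and> n1 = 0 \<and> n2 = 0)"
    proof
      assume "n0 = 0 \<and> n1 = 0 \<and> n2 = 0"
      then obtain k where k: "t0 = k * s0" "t1 = k * s1" "t2 = k * s2"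
        using parallel_imp_multiple[of s1 t2 s2 t1 t0 s0] s(2) by (auto simp: n)
      then have "k \<noteq> 0" using t(2) by auto
      then have "x' = x" unfolding s t k qsq_scale by (simp add: normalize_scale)
      then show False using xx by simp
    qed
    note ks = ker[OF xx(1)[unfolded s] s(2)] and kt = ker[OF xx(2)[unfolded t] t(2)]
    note row1 = parallel_to_cross[OF ks[THEN conjunct1] kt[THEN conjunct1], folded n]
    note row2 = parallel_to_cross[OF ks[THEN conjunct2, THEN conjunct1]
        kt[THEN conjunct2, THEN conjunct1], folded n]
    note row3 = parallel_to_cross[OF ks[THEN conjunct2, THEN conjunct2]
        kt[THEN conjunct2, THEN conjunct2], folded n]
    have minors: "\<mu> $ 1 * \<mu> $ 3 = \<mu> $ 2 * \<mu> $ 2" "\<mu> $ 2 * \<mu> $ 4 = \<mu> $ 3 * \<mu> $ 3"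
      "\<mu> $ 3 * \<mu> $ 5 = \<mu> $ 4 * \<mu> $ 4"
      using parallel_rows_minors[OF row1 row2 n_nz] parallel_rows_minors[OF row2 row3 n_nz] by auto
    \<comment> \<open>Rank 1 Hankel means that \<open>\<mu>\<close> is a multiple of (1, r, r^2,
      r^3, r^4), or of (0, 0, 0, 0, 1) when the point is infinity; kernel vectors are the quadratics
      vanishing there.\<close>
    obtain a b where common: "\<And>s0 s1 s2. normalize (qsq s0 s1 s2) \<in> F \<Longrightarrow>
      \<not> (s0 = 0 \<and> s1 = 0 \<and> s2 = 0) \<Longrightarrow> \<exists>c d e. qsq s0 s1 s2 = dbl a b c d e"
    proof (cases "\<mu> $ 1 = 0")
      case True
      then have "\<mu> $ 2 = 0" "\<mu> $ 3 = 0" "\<mu> $ 4 = 0" using minors by auto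
      moreover from this True have "\<mu> $ 5 \<noteq> 0" using \<open>\<mu> \<noteq> 0\<close> by (simp add: vec_eq_iff forall_5)
      ultimately have "s2 = 0" if "normalize (qsq s0 s1 s2) \<in> F" "\<not> (s0 = 0 \<and> s1 = 0 \<and> s2 = 0)"
        for s0 s1 s2 using ker[OF that] by simp
      then show thesis
        by (intro that[of 1 0]) (force simp: qsq_def dbl_def)
    next
      case False
      define r where "r = \<mu> $ 2 / \<mu> $ 1"
      have r: "\<mu> $ 2 = \<mu> $ 1 * r" "\<mu> $ 3 = \<mu> $ 1 * r^2"
        using False minors(1) by (auto simp: r_def power2_eq_square field_simps)
      have "qsq s0 s1 s2 = dbl (- r) 1 ((s1 + s2 * r)^2) (2 * (s1 + s2 * r) * s2) (s2^2)"
        if "normalize (qsq s0 s1 s2) \<in> F" "\<not> (s0 = 0 \<and> s1 = 0 \<and> s2 = 0)" for s0 s1 s2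
      proof -
        have "\<mu> $ 1 * (s0 + r * s1 + r^2 * s2) = 0"
          using ker[OF that] by (simp add: r algebra_simps)
        then have "s0 + r * s1 + r^2 * s2 = 0" using False by simp
        then have "s0 + r * (s1 + s2 * r) = 0" by (simp add: power2_eq_square algebra_simps)
        then have s0: "s0 = - r * (s1 + s2 * r)" by (simp add: eq_neg_iff_add_eq_0)
        show ?thesis
          unfolding s0 by (simp add: qsq_def dbl_def vec_eq_iff forall_5 power2_eq_square algebra_simps)
      qed
      then show thesis by (intro that[of "- r" 1]) blast
    qed
    \<comment> \<open>For a fixed double root, the quartics with it form a linear space, so the hull
      of the face stays inside.\<close>
    define E where "E = range (\<lambda>v::real^3. \<kappa> (dbl a b (v $ 1) (v $ 2) (v $ 3)))"
    have "convex E"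
      unfolding E_def
    proof (rule convex_linear_image)
      have "dbl a b ((v + w) $ 1) ((v + w) $ 2) ((v + w) $ 3) =
          dbl a b (v $ 1) (v $ 2) (v $ 3) + dbl a b (w $ 1) (w $ 2) (w $ 3)"
        "dbl a b ((k *\<^sub>R v) $ 1) ((k *\<^sub>R v) $ 2) ((k *\<^sub>R v) $ 3) =
          k *\<^sub>R dbl a b (v $ 1) (v $ 2) (v $ 3)" for v w :: "real^3" and k
        by (simp_all add: dbl_def vec_eq_iff forall_5 algebra_simps)
      then show "linear (\<lambda>v::real^3. \<kappa> (dbl a b (v $ 1) (v $ 2) (v $ 3)))"
        by (intro linearI) (simp_all only: linear_add[OF lin(1)] linear_scale[OF lin(1)])
    qed simp
    moreover have "F \<subseteq> E"
    proof
      fix x assume x: "x \<in> F"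
      then obtain s0 s1 s2 where s: "x = normalize (qsq s0 s1 s2)" "\<not> (s0 = 0 \<and> s1 = 0 \<and> s2 = 0)"
        unfolding F_def squares_def by blast
      then obtain c d e where "qsq s0 s1 s2 = dbl a b c d e" using common x by blast
      moreover define k where "k = inverse (l \<bullet> \<kappa> (qsq s0 s1 s2))"
      ultimately have "x = \<kappa> (k *\<^sub>R dbl a b c d e)"
        using s by (simp add: normalize_def linear_scale[OF lin(1)])
      also have "k *\<^sub>R dbl a b c d e = dbl a b (k * c) (k * d) (k * e)"
        by (simp add: dbl_def vec_eq_iff forall_5 algebra_simps)
      finally show "x \<in> E"
        unfolding E_def by (intro range_eqI[of _ _ "vector [k * c, k * d, k * e]"]) simp
    qed
    ultimately have "convex hull F \<subseteq> E" by (intro hull_minimal)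
    then obtain c d e where "y = \<kappa> (dbl a b c d e)" using yF by (auto simp: E_def)
    then show ?thesis by (simp add: inv qdisc_dbl)
  qed
qed

text \<open>The conditions say that the quadratic cofactor is positive definite. They are open in
  the parameters, which is what the density argument exploits.\<close>

lemma dbl_in_frontier:
  assumes ab: "a \<noteq> 0 \<or> b \<noteq> 0" and e: "e > 0" and disc: "d^2 < 4 * c * e"
  shows "l \<bullet> \<kappa> (dbl a b c d e) > 0"
    and "normalize (dbl a b c d e) \<in> (top_of_set (chart l)) frontier_of (convex hull squares)"
proof -
  \<comment> \<open>Completing the square writes the quartic as a combination of two squares.\<close>
  define q p where "q = qsq (a * (d / (2*e))) (a + b * (d / (2*e))) b" and "p = qsq a b 0"
  define k where "k = c - d^2 / (4*e)"
  have k: "k > 0" using e disc by (simp add: k_def field_simps)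
  have decomp: "dbl a b c d e = e *\<^sub>R q + k *\<^sub>R p"
    using e by (simp add: q_def p_def k_def qsq_def dbl_def vec_eq_iff forall_5 field_simps power2_eq_square)
  have q_nz: "\<not> (a * (d / (2*e)) = 0 \<and> a + b * (d / (2*e)) = 0 \<and> b = 0)"
    and p_nz: "\<not> (a = 0 \<and> b = 0 \<and> (0::real) = 0)" using ab by auto
  have lq: "l \<bullet> \<kappa> q > 0" and lp: "l \<bullet> \<kappa> p > 0"
    unfolding q_def p_def by (rule pos[OF q_nz], rule pos[OF p_nz])
  have lsum: "l \<bullet> \<kappa> (dbl a b c d e) = e * (l \<bullet> \<kappa> q) + k * (l \<bullet> \<kappa> p)"
    unfolding decomp by (simp add: linear_add[OF lin(1)] linear_scale[OF lin(1)] inner_add_right)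
  show lpos: "l \<bullet> \<kappa> (dbl a b c d e) > 0"
    unfolding lsum using lq lp e k by (simp add: add_pos_pos)
  let ?C = "convex hull squares" and ?y = "normalize (dbl a b c d e)" and ?N = "l \<bullet> \<kappa> (dbl a b c d e)"
  have "normalize q \<in> ?C" "normalize p \<in> ?C"
    unfolding q_def p_def squares_def using q_nz p_nz by (intro hull_inc; blast)+
  moreover have "?y = (e * (l \<bullet> \<kappa> q) / ?N) *\<^sub>R normalize q + (k * (l \<bullet> \<kappa> p) / ?N) *\<^sub>R normalize p"
    using lq lp by (simp add: normalize_def decomp linear_add[OF lin(1)] linear_scale[OF lin(1)]
        scaleR_add_right field_simps)
  moreover have "e * (l \<bullet> \<kappa> q) / ?N + k * (l \<bullet> \<kappa> p) / ?N = 1"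
    using lsum lpos by (simp flip: add_divide_distrib)
  moreover have "e * (l \<bullet> \<kappa> q) / ?N \<ge> 0" "k * (l \<bullet> \<kappa> p) / ?N \<ge> 0"
    using lq lp e k lpos by simp_all
  ultimately have yC: "?y \<in> ?C"
    by (auto intro: convexD[OF convex_convex_hull])
  \<comment> \<open>Evaluation at the double root \<open>-a/b\<close> supports the hull at the normalized quartic.\<close>
  define ev where "ev = quartic (b^4) (- (a * b^3)) (a^2 * b^2) (- (a^3 * b)) (a^4)"
  have ev_qsq: "ev \<bullet> qsq s0 s1 s2 = (s0 * b^2 - s1 * a * b + s2 * a^2)^2" for s0 s1 s2
    by (simp add: ev_def qsq_def inner_vec_def sum_5 power2_eq_square power3_eq_cube power4_eq_xxxx
        algebra_simps)
  have ev_dbl: "ev \<bullet> dbl a b c d e = 0"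
    by (simp add: ev_def dbl_def inner_vec_def sum_5 power2_eq_square power3_eq_cube power4_eq_xxxx
        algebra_simps)
  have g_norm: "g (normalize q) = inverse (l \<bullet> \<kappa> q) *\<^sub>R q" for q
    by (simp add: normalize_def linear_scale[OF lin(2)] inv)
  have "convex {x. ev \<bullet> g x \<ge> 0}"
  proof -
    have "{x. ev \<bullet> g x \<ge> 0} = {x. adjoint g ev \<bullet> x \<ge> 0}"
      using adjoint_works[OF lin(2)] by (simp add: inner_commute)
    then show ?thesis by (simp add: convex_halfspace_ge)
  qed
  moreover have "squares \<subseteq> {x. ev \<bullet> g x \<ge> 0}"
  proof
    fix x assume "x \<in> squares"
    then obtain s0 s1 s2 where "x = normalize (qsq s0 s1 s2)" "\<not> (s0 = 0 \<and> s1 = 0 \<and> s2 = 0)"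
      by (auto simp: squares_def)
    then show "x \<in> {x. ev \<bullet> g x \<ge> 0}"
      using pos[of s0 s1 s2] by (simp add: g_norm ev_qsq)
  qed
  ultimately have C_ev: "ev \<bullet> g x \<ge> 0" if "x \<in> ?C" for x
    using that hull_minimal[of squares "{x. ev \<bullet> g x \<ge> 0}" convex] by blast
  \<comment> \<open>The quadratic with the coefficients of the evaluation functional itself, so that
    its value is the positive number b^4 + a^2 b^2 + a^4. Moving from \<open>?y\<close> away from
    \<open>w\<close> makes the supporting functional negative.\<close>
  define w where "w = normalize (qsq (b^2) (- a * b) (a^2))"
  have w_nz: "\<not> (b^2 = 0 \<and> - a * b = 0 \<and> a^2 = 0)" using ab by auto
  have w_chart: "w \<in> chart l" unfolding w_def by (rule normalize_in_chart) (rule pos[OF w_nz])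
  have "b^2 * b^2 - (- a * b) * a * b + a^2 * a^2 > 0"
  proof -
    have "a^2 * a^2 + b^2 * b^2 > 0" using ab
      by (metis add.commute add_nonneg_pos add_pos_nonneg mult_pos_pos zero_le_power2 zero_less_power2 mult_nonneg_nonneg)
    moreover have "(a * b)^2 \<ge> 0" by simp
    ultimately show ?thesis by (simp add: power2_eq_square algebra_simps)
  qed
  then have w_ev: "ev \<bullet> g w > 0"
    unfolding w_def g_norm using pos[OF w_nz] by (simp add: ev_qsq)
  have "?y \<notin> (top_of_set (chart l)) interior_of ?C"
  proof
    assume "?y \<in> (top_of_set (chart l)) interior_of ?C"
    then obtain U where U: "openin (top_of_set (chart l)) U" "?y \<in> U" "U \<subseteq> ?C"
      by (auto simp: interior_of_def)
    then obtain \<epsilon> where \<epsilon>: "\<epsilon> > 0" "\<And>x. x \<in> chart l \<Longrightarrow> dist x ?y < \<epsilon> \<Longrightarrow> x \<in> U"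
      by (metis openin_euclidean_subtopology_iff)
    \<comment> \<open>The summand 1 keeps \<open>K\<close> positive without having to know that
      \<open>?y\<close> and \<open>w\<close> differ.\<close>
    define K where "K = norm (?y - w) + 1"
    define \<delta> where "\<delta> = \<epsilon> / (2 * K)"
    have n: "K > 0" by (simp add: K_def add_nonneg_pos)
    then have \<delta>: "\<delta> > 0" using \<epsilon>(1) by (simp add: \<delta>_def)
    let ?x = "?y + \<delta> *\<^sub>R (?y - w)"
    have "?y \<in> chart l" using normalize_in_chart lpos by simp
    then have "?x \<in> chart l" using w_chart by (simp add: chart_def inner_add_right inner_diff_right)
    moreover have "dist ?x ?y < \<epsilon>"
    proof -
      have "dist ?x ?y = \<delta> * norm (?y - w)" using \<delta> by (simp add: dist_norm)
      also have "\<dots> \<le> \<delta> * K" using \<delta> by (simp add: K_def)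
      also have "\<dots> = \<epsilon> / 2" using n by (simp add: \<delta>_def)
      also have "\<dots> < \<epsilon>" using \<epsilon>(1) by simp
      finally show ?thesis .
    qed
    ultimately have "?x \<in> ?C" using \<epsilon>(2) U(3) by blast
    then have "ev \<bullet> g ?x \<ge> 0" by (rule C_ev)
    moreover have "ev \<bullet> g ?x = - (\<delta> * (ev \<bullet> g w))"
      by (simp add: linear_add[OF lin(2)] linear_diff[OF lin(2)] linear_scale[OF lin(2)] inner_add_right
          inner_diff_right g_norm ev_dbl)
    ultimately show False using mult_pos_pos[OF \<delta> w_ev] by linarith
  qed
  moreover have "?y \<in> (top_of_set (chart l)) closure_of ?C"
    using closure_of_subset[of ?C "top_of_set (chart l)"] hull_in_chart yC by auto
  ultimately show "?y \<in> (top_of_set (chart l)) frontier_of ?C"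
    by (simp add: frontier_of_def)
qed

text \<open>For fixed other parameters the expression is a univariate polynomial, so the real ranges
  can be released to the complex numbers one parameter at a time, in the order a, b, c, d,
  e.\<close>

lemma vanishing_on_dbl:
  assumes hom: "homogeneous k p"
    and van: "real_pt ` ((top_of_set (chart l)) frontier_of (convex hull squares)) \<subseteq> zero_locus p"
  shows "mpoly_eval p (cext \<kappa> (dbl a b c d e)) = 0"
proof -
  let ?R = "\<lambda>S. complex_of_real ` S"
  let ?h = "\<lambda>a b c d e. mpoly_eval p (cext \<kappa> (dbl a b c d e))"
  \<comment> \<open>A box inside the region d^2 < 4 c e: each parameter has an infinite range
    independent of the others, and b is unrestricted.\<close>
  have real: "?h (of_real a) (of_real b) (of_real c) (of_real d) (of_real e) = 0"
    if "a > 0" "c > 1" "e > 1" "0 < d" "d < 1" for a b c d e :: real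
  proof -
    have "1 < c * e" using that by (simp add: less_1_mult)
    moreover have "d^2 < 1" using that by (simp add: power_less_one_iff)
    ultimately have "d^2 < 4 * c * e" by simp
    then have fr: "l \<bullet> \<kappa> (dbl a b c d e) > 0"
      "normalize (dbl a b c d e) \<in> (top_of_set (chart l)) frontier_of (convex hull squares)"
      using dbl_in_frontier[of a b e d c] that by auto
    define k where "k = inverse (l \<bullet> \<kappa> (dbl a b c d e))"
    have k: "k \<noteq> 0" using fr(1) by (simp add: k_def)
    have nz: "normalize (dbl a b c d e) \<noteq> 0" using fr(1) by (auto simp: normalize_def)
    have "real_pt (normalize (dbl a b c d e)) \<in> zero_locus p" using van fr(2) by blast
    then have "mpoly_eval p (cvec (normalize (dbl a b c d e))) = 0"
      using nz by (simp add: real_pt_eq pt_in_zero_locus_iff[OF hom])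
    then have "mpoly_eval p (cvec (\<kappa> (dbl a b c d e))) = 0"
      using fr(1) by (simp add: normalize_def cvec_scaleR mpoly_eval_scale[OF hom])
    moreover have "cvec (dbl a b c d e) = dbl (of_real a) (of_real b) (of_real c) (of_real d) (of_real e)"
      by (simp add: vec_eq_iff forall_5 dbl_def)
    ultimately show ?thesis by (metis cext_cvec lin(1))
  qed
  have inf: "infinite (?R {0<..})" "infinite (?R {1<..})" "infinite (?R {0<..<1})" "infinite (?R UNIV)"
    by (auto simp: finite_image_iff inj_on_def infinite_Ioi infinite_UNIV_char_0)
  have poly: "is_poly_fun (\<lambda>z. ?h (f1 z) (f2 z) (f3 z) (f4 z) (f5 z))"
    if f: "is_poly_fun f1" "is_poly_fun f2" "is_poly_fun f3" "is_poly_fun f4" "is_poly_fun f5"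
    for f1 f2 f3 f4 f5
  proof (intro is_poly_fun_mpoly_eval is_poly_fun_cext)
    have "is_poly_fun (\<lambda>z. dbl (f1 z) (f2 z) (f3 z) (f4 z) (f5 z) $ j)" if "j \<in> {1,2,3,4,5}" for j :: 5
      using that f unfolding dbl_def
      by (auto intro!: is_poly_fun_add is_poly_fun_mult is_poly_fun_power is_poly_fun_const)
    then show "is_poly_fun (\<lambda>z. dbl (f1 z) (f2 z) (f3 z) (f4 z) (f5 z) $ j)" for j
      using UNIV_5 by blast
  qed
  note ci = is_poly_fun_const is_poly_fun_id
  have 1: "?h a (of_real b) (of_real c) (of_real d) (of_real e) = 0"
    if "c > 1" "e > 1" "0 < d" "d < 1" for a :: complex and b c d e :: real
    by (rule is_poly_fun_zero[OF poly[OF ci(2) ci(1) ci(1) ci(1) ci(1)] inf(1)]) (use real that in auto)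
  have 2: "?h a b (of_real c) (of_real d) (of_real e) = 0"
    if "c > 1" "e > 1" "0 < d" "d < 1" for a b :: complex and c d e :: real
    by (rule is_poly_fun_zero[OF poly[OF ci(1) ci(2) ci(1) ci(1) ci(1)] inf(4)]) (use 1 that in auto)
  have 3: "?h a b c (of_real d) (of_real e) = 0"
    if "e > 1" "0 < d" "d < 1" for a b c :: complex and d e :: real
    by (rule is_poly_fun_zero[OF poly[OF ci(1) ci(1) ci(2) ci(1) ci(1)] inf(2)]) (use 2 that in auto)
  have 4: "?h a b c d (of_real e) = 0" if "e > 1" for a b c d :: complex and e :: real
    by (rule is_poly_fun_zero[OF poly[OF ci(1) ci(1) ci(1) ci(2) ci(1)] inf(3)]) (use 3 that in auto)
  show ?thesis
    by (rule is_poly_fun_zero[OF poly[OF ci(1) ci(1) ci(1) ci(1) ci(2)] inf(2)]) (use 4 in auto)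
qed

lemma boundary_hypersurface:
  assumes "compact squares"
  shows "hypersurface_of_degree 6
    (zariski_closure (real_pt ` ((top_of_set (chart l)) frontier_of (convex hull squares))))"
proof -
  obtain f where f: "homogeneous 6 f" "\<And>v. mpoly_eval f v = qdisc (cext g v)"
    using homogeneous_fun_qdisc_cext[of g] by (auto simp: homogeneous_fun_def)
  have "squarefree f"
    by (rule squarefree_qdisc[OF f, where h = \<kappa>]) (simp add: cext_inverse lin inv)
  moreover have "zariski_closure (real_pt ` ((top_of_set (chart l)) frontier_of (convex hull squares))) =
      zero_locus f"
  proof (rule zariski_closure_eq_zero_locus[OF f(1)])
    show "real_pt ` ((top_of_set (chart l)) frontier_of (convex hull squares)) \<subseteq> zero_locus f"
    proof (rule image_subsetI)
      fix y assume y: "y \<in> (top_of_set (chart l)) frontier_of (convex hull squares)"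
      then have "y \<in> chart l" using frontier_of_subset_topspace by fastforce
      then have "cvec y \<noteq> 0" by (auto simp: chart_def)
      moreover have "qdisc (cvec q) = complex_of_real (qdisc q)" for q :: "real^5"
        by (simp add: qdisc_def invI_def invJ_def)
      then have "mpoly_eval f (cvec y) = 0"
        using qdisc_frontier[OF assms y] by (simp add: f(2) cext_cvec lin)
      ultimately show "real_pt y \<in> zero_locus f"
        by (simp add: real_pt_eq pt_in_zero_locus_iff[OF f(1)])
    qed
    fix k p and v :: "complex^5"
    assume p: "homogeneous k p"
      "real_pt ` ((top_of_set (chart l)) frontier_of (convex hull squares)) \<subseteq> zero_locus p"
      and "mpoly_eval f v = 0"
    then obtain a b c d e where "cext g v = dbl a b c d e"
      using qdisc_0_imp_dbl f(2) by metis
    then have "v = cext \<kappa> (dbl a b c d e)" by (metis cext_inverse lin inv(2))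
    then show "mpoly_eval p v = 0" by (simp add: vanishing_on_dbl[OF p])
  qed
  ultimately show ?thesis using f(1) by (auto simp: hypersurface_of_degree_def)
qed

end

section \<open>Projections from a point of full rank\<close>

context
  fixes A :: "real^3^3" and \<pi> :: "real^3^3 \<Rightarrow> real^5"
  assumes proj: "projection_from A \<pi>"
begin

lemma form_proj_outer:
  "real_quadratic_form (\<lambda>t. l \<bullet> \<pi> (outer t t)) (\<lambda>s t. l \<bullet> \<pi> (outer s t + outer t s))"
  by unfold_locales (simp add: proj_outer_combination[OF proj] inner_add_right)

lemma form_nonzero: "l \<noteq> 0 \<Longrightarrow> \<exists>t. l \<bullet> \<pi> (outer t t) \<noteq> 0"
  using proj_squares_span[OF proj] by blast

lemma proj_center: "\<pi> A = 0"
  using proj by (auto simp: projection_from_def span_base)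

text \<open>Since \<open>\<pi> A = 0\<close>, a positive combination of the values of the form at
  the vectors of B is zero. If no value were positive, all of these would vanish, and the zeros of a
  semidefinite form make up a subspace, here everything.\<close>

lemma definite_center_form_pos:
  assumes A: "A = (\<Sum>v\<in>B. \<mu> v *\<^sub>R outer v v)" "finite B" "span B = UNIV"
    and \<mu>: "\<And>v. v \<in> B \<Longrightarrow> \<mu> v > 0" and l: "l \<noteq> 0"
  obtains t where "l \<bullet> \<pi> (outer t t) > 0"
proof (rule ccontr)
  assume no: "\<not> thesis"
  have neg: "l \<bullet> \<pi> (outer t t) \<le> 0" for t
    using no that[of t] by (meson not_le_imp_less)
  interpret real_quadratic_form "\<lambda>t. - l \<bullet> \<pi> (outer t t)" "\<lambda>s t. - l \<bullet> \<pi> (outer s t + outer t s)"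
    by (rule form_proj_outer)
  have nonneg: "- l \<bullet> \<pi> (outer t t) \<ge> 0" for t using neg[of t] by simp
  have "- l \<bullet> \<pi> A = (\<Sum>v\<in>B. \<mu> v * (- l \<bullet> \<pi> (outer v v)))"
    unfolding A(1) using linear_proj[OF proj]
    by (simp add: linear_sum linear_scale inner_sum_right sum_negf)
  then have sum0: "(\<Sum>v\<in>B. \<mu> v * (- l \<bullet> \<pi> (outer v v))) = 0" by (simp add: proj_center)
  have h: "\<mu> v * (- l \<bullet> \<pi> (outer v v)) \<ge> 0" if "v \<in> B" for v
    by (intro mult_nonneg_nonneg less_imp_le[OF \<mu>] nonneg that)
  have "\<forall>v\<in>B. \<mu> v * (- l \<bullet> \<pi> (outer v v)) = 0"
    using sum_nonneg_eq_0_iff[of B "\<lambda>v. \<mu> v * (- l \<bullet> \<pi> (outer v v))"] A(2) h sum0 by blast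
  then have "B \<subseteq> {t. - l \<bullet> \<pi> (outer t t) = 0}" using \<mu> by fastforce
  then have "span B \<subseteq> {t. - l \<bullet> \<pi> (outer t t) = 0}"
    by (rule span_minimal[OF _ subspace_zeros[OF nonneg]])
  then have "l \<bullet> \<pi> (outer t t) = 0" for t using A(3) by auto
  then show False using form_nonzero[OF l] by blast
qed

lemma definite_sign:
  assumes "\<And>t. t \<noteq> 0 \<Longrightarrow> l \<bullet> \<pi> (outer t t) \<noteq> 0"
  shows "(\<forall>t. t \<noteq> 0 \<longrightarrow> l \<bullet> \<pi> (outer t t) > 0) \<or> (\<forall>t. t \<noteq> 0 \<longrightarrow> l \<bullet> \<pi> (outer t t) < 0)"
proof -
  interpret L: real_quadratic_form "\<lambda>t. l \<bullet> \<pi> (outer t t)" "\<lambda>s t. l \<bullet> \<pi> (outer s t + outer t s)"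
    by (rule form_proj_outer)
  have "\<not> (l \<bullet> \<pi> (outer u u) > 0 \<and> l \<bullet> \<pi> (outer v v) < 0)" for u v
    using L.isotropic_between[of u v] assms by metis
  then show ?thesis using assms by (meson linorder_neqE_linordered_idom)
qed

text \<open>If \<open>2 A = 2 k1 k1^T - k0 k2^T - k2 k0^T\<close>, then modulo \<open>A\<close> the matrix \<open>t t^T\<close> with
  \<open>t = s0 k0 + s1 k1 + s2 k2\<close> depends only on the coefficients of the quartic \<open>(s0 + s1 x + s2 x^2)^2\<close>.\<close>

lemma quartic_normal_form:
  assumes A: "2 *\<^sub>R A = 2 *\<^sub>R outer k1 k1 - (outer k0 k2 + outer k2 k0)"
    and span: "span {k0, k1, k2} = UNIV"
  obtains \<kappa> g :: "real^5 \<Rightarrow> real^5" where "linear \<kappa>" "linear g" "\<forall>q. g (\<kappa> q) = q" "\<forall>y. \<kappa> (g y) = y"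
    "\<forall>s0 s1 s2. \<kappa> (qsq s0 s1 s2) =
      \<pi> (outer (s0 *\<^sub>R k0 + s1 *\<^sub>R k1 + s2 *\<^sub>R k2) (s0 *\<^sub>R k0 + s1 *\<^sub>R k1 + s2 *\<^sub>R k2))"
    "\<forall>t. \<exists>s0 s1 s2. t = s0 *\<^sub>R k0 + s1 *\<^sub>R k1 + s2 *\<^sub>R k2"
proof -
  note lin = linear_proj[OF proj]
  \<comment> \<open>The halves match the factors 2 in the odd coefficients of a square. The middle
    coefficient 2 s0 s2 + s1^2 needs a single term because \<open>k02\<close> identifies the two
    matrices that contribute to it.\<close>
  define \<kappa> where "\<kappa> q = (q $ 1) *\<^sub>R \<pi> (outer k0 k0) + (q $ 2 / 2) *\<^sub>R \<pi> (outer k0 k1 + outer k1 k0)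
     + (q $ 3) *\<^sub>R \<pi> (outer k1 k1) + (q $ 4 / 2) *\<^sub>R \<pi> (outer k1 k2 + outer k2 k1)
     + (q $ 5) *\<^sub>R \<pi> (outer k2 k2)" for q :: "real^5"
  have "\<pi> (2 *\<^sub>R A) = 0" using lin by (simp add: linear_scale proj_center)
  then have k02: "\<pi> (outer k0 k2 + outer k2 k0) = 2 *\<^sub>R \<pi> (outer k1 k1)"
    unfolding A using lin by (simp only: linear_diff linear_scale) simp
  have sq: "\<kappa> (qsq s0 s1 s2) =
      \<pi> (outer (s0 *\<^sub>R k0 + s1 *\<^sub>R k1 + s2 *\<^sub>R k2) (s0 *\<^sub>R k0 + s1 *\<^sub>R k1 + s2 *\<^sub>R k2))" for s0 s1 s2
  proof -
    have "outer (s0 *\<^sub>R k0 + s1 *\<^sub>R k1 + s2 *\<^sub>R k2) (s0 *\<^sub>R k0 + s1 *\<^sub>R k1 + s2 *\<^sub>R k2) =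
        s0^2 *\<^sub>R outer k0 k0 + (s0 * s1) *\<^sub>R (outer k0 k1 + outer k1 k0) + s1^2 *\<^sub>R outer k1 k1
        + (s0 * s2) *\<^sub>R (outer k0 k2 + outer k2 k0) + (s1 * s2) *\<^sub>R (outer k1 k2 + outer k2 k1)
        + s2^2 *\<^sub>R outer k2 k2"
      by (simp add: vec_eq_iff power2_eq_square algebra_simps)
    then have "\<pi> (outer (s0 *\<^sub>R k0 + s1 *\<^sub>R k1 + s2 *\<^sub>R k2) (s0 *\<^sub>R k0 + s1 *\<^sub>R k1 + s2 *\<^sub>R k2)) =
        s0^2 *\<^sub>R \<pi> (outer k0 k0) + (s0 * s1) *\<^sub>R \<pi> (outer k0 k1 + outer k1 k0) + s1^2 *\<^sub>R \<pi> (outer k1 k1)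
        + (s0 * s2) *\<^sub>R (2 *\<^sub>R \<pi> (outer k1 k1)) + (s1 * s2) *\<^sub>R \<pi> (outer k1 k2 + outer k2 k1)
        + s2^2 *\<^sub>R \<pi> (outer k2 k2)"
      using lin by (simp only: linear_add[of \<pi> "_ + _" "_ *\<^sub>R _"] linear_add[of \<pi> "_ *\<^sub>R _" "_ *\<^sub>R _"]
          linear_scale k02)
    then show ?thesis by (simp add: \<kappa>_def qsq_def algebra_simps)
  qed
  have linear: "linear \<kappa>"
    by (rule linearI) (simp_all add: \<kappa>_def algebra_simps add_divide_distrib)
  have comb: "\<exists>s0 s1 s2. t = s0 *\<^sub>R k0 + s1 *\<^sub>R k1 + s2 *\<^sub>R k2" for t
  proof -
    have "t \<in> span {k0, k1, k2}" using span by simp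
    then obtain s0 s1 s2 where "t - s0 *\<^sub>R k0 - s1 *\<^sub>R k1 - s2 *\<^sub>R k2 \<in> span {}"
      by (auto simp only: span_breakdown_eq)
    then have "t = s0 *\<^sub>R k0 + s1 *\<^sub>R k1 + s2 *\<^sub>R k2" by (simp add: algebra_simps)
    then show ?thesis by blast
  qed
  \<comment> \<open>A functional killing the range kills every projected rank-one matrix, hence is
    zero; equal dimensions then turn surjectivity into an isomorphism.\<close>
  have "range \<kappa> = UNIV"
  proof (rule ccontr)
    assume "range \<kappa> \<noteq> UNIV"
    moreover have "subspace (range \<kappa>)" by (rule linear_subspace_image[OF linear subspace_UNIV])
    then have "span (range \<kappa>) = range \<kappa>" by (simp only: span_eq_iff)
    ultimately have "span (range \<kappa>) \<subset> UNIV" by blast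
    then obtain m where m: "m \<noteq> 0" "\<And>y. y \<in> span (range \<kappa>) \<Longrightarrow> orthogonal m y"
      using orthogonal_to_subspace_exists_gen[of "range \<kappa>" UNIV] by auto
    have "m \<bullet> \<pi> (outer t t) = 0" for t
    proof -
      obtain s0 s1 s2 where "t = s0 *\<^sub>R k0 + s1 *\<^sub>R k1 + s2 *\<^sub>R k2" using comb by blast
      then have "\<pi> (outer t t) = \<kappa> (qsq s0 s1 s2)" by (simp add: sq)
      then show ?thesis using m(2) by (simp add: orthogonal_def span_base)
    qed
    then show False using proj_squares_span[OF proj] m(1) by blast
  qed
  then obtain g where g: "linear g" "g \<circ> \<kappa> = id" "\<kappa> \<circ> g = id"
    using linear_surjective_isomorphism[OF linear] by (auto simp: fun_eq_iff)
  show thesis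
    by (rule that[OF linear g(1)]) (use g(2,3) sq comb in \<open>auto simp: fun_eq_iff\<close>)
qed

context
  assumes rank: "rank A = 3"
begin

lemma conv_of_definite_center:
  assumes A: "A = (\<Sum>v\<in>B. \<mu> v *\<^sub>R outer v v)" "finite B" "span B = UNIV"
    and \<mu>: "\<And>v. v \<in> B \<Longrightarrow> \<mu> v > 0" and l: "l \<noteq> 0"
  shows "conv_in_chart l (projected_veronese \<pi>) = chart l"
proof -
  define X where "X = real_points_in_chart l (projected_veronese \<pi>)"
  note Xeq = real_points_in_chart_eq[OF proj rank, of l, folded X_def]
  have sub: "convex hull X \<subseteq> chart l"
    by (rule hull_minimal) (auto simp: X_def real_points_in_chart_def chart_def convex_hyperplane)
  obtain u where u: "l \<bullet> \<pi> (outer u u) > 0" by (rule definite_center_form_pos[OF A \<mu> l])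
  obtain v where "(- l) \<bullet> \<pi> (outer v v) > 0"
    by (rule definite_center_form_pos[OF A \<mu>, of "- l"]) (use l in auto)
  then have v: "l \<bullet> \<pi> (outer v v) < 0" by simp
  have "z \<in> convex hull X" if z: "z \<in> chart l" for z
  proof (rule ccontr)
    assume "z \<notin> convex hull X"
    then have nint: "z \<notin> (top_of_set (chart l)) interior_of (convex hull X)"
      by (rule contra_subsetD[OF interior_of_subset])
    have "inverse (l \<bullet> \<pi> (outer u u)) *\<^sub>R \<pi> (outer u u) \<in> X"
      unfolding Xeq using u by force
    then have ne: "convex hull X \<noteq> {}" by auto
    obtain m where m: "m \<noteq> 0" "m \<bullet> z = 0" "\<And>y. y \<in> convex hull X \<Longrightarrow> m \<bullet> y \<ge> 0"
      using supporting_functional_in_chart[OF convex_convex_hull ne sub l z nint] by metis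
    have "(m \<bullet> \<pi> (outer t t)) * (l \<bullet> \<pi> (outer t t)) \<ge> 0" for t
    proof (cases "l \<bullet> \<pi> (outer t t) = 0")
      case False
      then have "inverse (l \<bullet> \<pi> (outer t t)) *\<^sub>R \<pi> (outer t t) \<in> convex hull X"
        by (intro hull_inc) (auto simp: Xeq)
      then have "m \<bullet> (inverse (l \<bullet> \<pi> (outer t t)) *\<^sub>R \<pi> (outer t t)) \<ge> 0" by (rule m(3))
      then have "inverse (l \<bullet> \<pi> (outer t t)) * (m \<bullet> \<pi> (outer t t)) \<ge> 0" by simp
      then show ?thesis using False by (auto simp: zero_le_mult_iff)
    qed simp
    then obtain c where c: "\<And>t. m \<bullet> \<pi> (outer t t) = c * (l \<bullet> \<pi> (outer t t))"
      using same_sign_forms_proportional[OF form_proj_outer form_proj_outer _ u v] by metis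
    have "(m - c *\<^sub>R l) \<bullet> \<pi> (outer t t) = 0" for t by (simp add: c inner_diff_left)
    then have "m - c *\<^sub>R l = 0" by (rule proj_squares_span[OF proj])
    then have mc: "m = c *\<^sub>R l" by simp
    then have "c = 0" using m(2) z by (simp add: chart_def)
    then show False using mc m(1) by simp
  qed
  then show ?thesis using sub by (auto simp: conv_in_chart_def X_def)
qed

text \<open>Near an isotropic \<open>t0\<close> the numerator tends to the nonzero vector
  \<open>\<pi> (outer t0 t0)\<close> while the normalizing value of \<open>l\<close> tends to 0, so
  points of the chart would be unbounded.\<close>

lemma definite_of_compact:
  assumes l: "l \<noteq> 0" and compact: "compact (real_points_in_chart l (projected_veronese \<pi>))"
    and t0: "t0 \<noteq> 0"
  shows "l \<bullet> \<pi> (outer t0 t0) \<noteq> 0"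
proof
  interpret L: real_quadratic_form "\<lambda>t. l \<bullet> \<pi> (outer t t)" "\<lambda>s t. l \<bullet> \<pi> (outer s t + outer t s)"
    by (rule form_proj_outer)
  assume 0: "l \<bullet> \<pi> (outer t0 t0) = 0"
  obtain R where R: "\<And>y. y \<in> real_points_in_chart l (projected_veronese \<pi>) \<Longrightarrow> norm y \<le> R"
    using compact_imp_bounded[OF compact] by (auto simp: bounded_iff)
  have bound: "norm (\<pi> (outer t t)) \<le> R * \<bar>l \<bullet> \<pi> (outer t t)\<bar>" if "l \<bullet> \<pi> (outer t t) \<noteq> 0" for t
  proof -
    have "norm (inverse (l \<bullet> \<pi> (outer t t)) *\<^sub>R \<pi> (outer t t)) \<le> R"
      by (rule R) (use that in \<open>auto simp: real_points_in_chart_eq[OF proj rank]\<close>)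
    then show ?thesis using that by (simp add: field_simps)
  qed
  obtain w where w: "l \<bullet> \<pi> (outer w w) \<noteq> 0" using form_nonzero[OF l] by blast
  define p where "p = l \<bullet> \<pi> (outer w t0 + outer t0 w)"
  define c where "c = l \<bullet> \<pi> (outer w w)"
  define P where "P x = \<pi> (outer (x *\<^sub>R w + t0) (x *\<^sub>R w + t0))" for x :: real
  have P: "P x = x^2 *\<^sub>R \<pi> (outer w w) + x *\<^sub>R \<pi> (outer w t0 + outer t0 w) + \<pi> (outer t0 t0)" for x
    using proj_outer_combination[OF proj, of x w 1 t0] by (simp add: P_def)
  have LP: "l \<bullet> P x = x * (c * x + p)" for x
    using L.line[of x w t0] by (simp add: P_def 0 c_def p_def power2_eq_square algebra_simps)
  have lim: "(P \<longlongrightarrow> \<pi> (outer t0 t0)) (at 0)"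
    unfolding P by (rule tendsto_eq_intros refl | simp)+
  \<comment> \<open>This keeps the nearby parameters off the hyperplane. If \<open>p = 0\<close> it
    rests on \<open>c \<noteq> 0\<close>, which the choice of \<open>w\<close> ensures.\<close>
  have "\<forall>\<^sub>F x in at 0. c * x + p \<noteq> 0"
  proof (cases "p = 0")
    case True
    then show ?thesis using w by (simp add: eventually_at_filter c_def)
  next
    case False
    have "((\<lambda>x. c * x + p) \<longlongrightarrow> p) (at 0)" by (rule tendsto_eq_intros refl | simp)+
    then show ?thesis using False by (rule tendsto_imp_eventually_ne)
  qed
  moreover have "\<forall>\<^sub>F x in at 0. x \<noteq> (0::real)" by (simp add: eventually_at_filter)
  ultimately have "\<forall>\<^sub>F x in at 0. norm (P x) \<le> R * \<bar>l \<bullet> P x\<bar>"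
  proof eventually_elim
    case (elim x)
    then have "l \<bullet> P x \<noteq> 0" by (simp add: LP)
    then show ?case unfolding P_def by (rule bound)
  qed
  moreover have "((\<lambda>x. norm (P x)) \<longlongrightarrow> norm (\<pi> (outer t0 t0))) (at 0)"
    by (rule tendsto_norm[OF lim])
  moreover have "((\<lambda>x. R * \<bar>l \<bullet> P x\<bar>) \<longlongrightarrow> R * \<bar>l \<bullet> \<pi> (outer t0 t0)\<bar>) (at 0)"
    by (intro tendsto_intros lim)
  ultimately have "norm (\<pi> (outer t0 t0)) \<le> R * \<bar>l \<bullet> \<pi> (outer t0 t0)\<bar>"
    using tendsto_le[OF trivial_limit_at] by blast
  then show False using proj_outer_self_nonzero[OF proj rank t0] by (simp add: 0)
qed

lemma compact_of_definite:
  assumes pos: "\<And>t. t \<noteq> 0 \<Longrightarrow> l \<bullet> \<pi> (outer t t) > 0"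
  shows "compact (real_points_in_chart l (projected_veronese \<pi>))"
proof -
  interpret L: real_quadratic_form "\<lambda>t. l \<bullet> \<pi> (outer t t)" "\<lambda>s t. l \<bullet> \<pi> (outer s t + outer t s)"
    by (rule form_proj_outer)
  define G where "G t = inverse (l \<bullet> \<pi> (outer t t)) *\<^sub>R \<pi> (outer t t)" for t
  have z: "l \<bullet> \<pi> (outer 0 0) = 0" using L.scale[of 0 0] by simp
  have G_scale: "G (k *\<^sub>R t) = G t" if "k \<noteq> 0" for k t
    using that by (simp add: G_def proj_outer_scale[OF proj])
  have image: "real_points_in_chart l (projected_veronese \<pi>) = G ` sphere 0 1"
  proof (intro set_eqI iffI)
    fix y assume "y \<in> real_points_in_chart l (projected_veronese \<pi>)"
    then obtain t where t: "y = G t" "l \<bullet> \<pi> (outer t t) \<noteq> 0"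
      by (auto simp: real_points_in_chart_eq[OF proj rank] G_def)
    then have "t \<noteq> 0" using z by auto
    then have "G t = G (inverse (norm t) *\<^sub>R t)" "inverse (norm t) *\<^sub>R t \<in> sphere 0 1"
      by (simp_all add: G_scale)
    then show "y \<in> G ` sphere 0 1" using t(1) by blast
  next
    fix y assume "y \<in> G ` sphere 0 1"
    then obtain t where t: "y = G t" "norm t = 1" by auto
    then have "t \<noteq> 0" by auto
    then have "l \<bullet> \<pi> (outer t t) \<noteq> 0" using pos[of t] by simp
    then show "y \<in> real_points_in_chart l (projected_veronese \<pi>)"
      using t(1) by (auto simp: real_points_in_chart_eq[OF proj rank] G_def)
  qed
  have "continuous_on (sphere 0 1) (\<lambda>t. \<pi> (outer t t))"
  proof -
    have "continuous_on (sphere 0 1) (\<lambda>t::real^3. outer t t)"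
      unfolding outer_def by (intro continuous_intros)
    then show ?thesis
      by (rule continuous_on_compose2[OF linear_continuous_on[OF
            linear_proj[OF proj, unfolded linear_conv_bounded_linear]] _ subset_UNIV])
  qed
  moreover have "\<forall>t\<in>sphere 0 1. l \<bullet> \<pi> (outer t t) \<noteq> 0"
  proof
    fix t :: "real^3" assume "t \<in> sphere 0 1"
    then have "t \<noteq> 0" by auto
    then show "l \<bullet> \<pi> (outer t t) \<noteq> 0" using pos[of t] by simp
  qed
  ultimately have "continuous_on (sphere 0 1) G"
    unfolding G_def by (intro continuous_intros) auto
  then show ?thesis unfolding image by (rule compact_continuous_image[OF _ compact_sphere])
qed

lemma indefinite_center:
  assumes A: "2 *\<^sub>R A = 2 *\<^sub>R outer k1 k1 - (outer k0 k2 + outer k2 k0)"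
    and span: "span {k0, k1, k2} = UNIV"
  shows "\<exists>l. l \<noteq> 0 \<and> compact (real_points_in_chart l (projected_veronese \<pi>))"
    and "l \<noteq> 0 \<Longrightarrow> compact (real_points_in_chart l (projected_veronese \<pi>)) \<Longrightarrow>
      hypersurface_of_degree 6 (algebraic_boundary l (projected_veronese \<pi>))"
proof -
  obtain \<kappa> g :: "real^5 \<Rightarrow> real^5" where lin: "linear \<kappa>" "linear g"
    and inv: "\<forall>q. g (\<kappa> q) = q" "\<forall>y. \<kappa> (g y) = y"
    and sq: "\<forall>s0 s1 s2. \<kappa> (qsq s0 s1 s2) =
      \<pi> (outer (s0 *\<^sub>R k0 + s1 *\<^sub>R k1 + s2 *\<^sub>R k2) (s0 *\<^sub>R k0 + s1 *\<^sub>R k1 + s2 *\<^sub>R k2))"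
    and comb: "\<forall>t. \<exists>s0 s1 s2. t = s0 *\<^sub>R k0 + s1 *\<^sub>R k1 + s2 *\<^sub>R k2"
    by (rule quartic_normal_form[OF A span])
  note inv = inv[rule_format] and sq = sq[rule_format] and comb = comb[rule_format]
  have zero: "\<kappa> (qsq 0 0 0) = 0"
  proof -
    have "qsq 0 0 0 = (0 :: real^5)" by (simp add: qsq_def vec_eq_iff forall_5)
    then show ?thesis by (simp add: linear_0[OF lin(1)])
  qed
  have indep: "s0 *\<^sub>R k0 + s1 *\<^sub>R k1 + s2 *\<^sub>R k2 \<noteq> 0" if "\<not> (s0 = 0 \<and> s1 = 0 \<and> s2 = 0)" for s0 s1 s2
  proof
    assume "s0 *\<^sub>R k0 + s1 *\<^sub>R k1 + s2 *\<^sub>R k2 = 0"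
    then have "\<kappa> (qsq s0 s1 s2) = \<kappa> (qsq 0 0 0)" by (simp add: sq)
    then have "qsq s0 s1 s2 = qsq 0 0 0" by (metis inv(1))
    then show False using that by (auto simp: qsq_def vec_eq_iff forall_5)
  qed
  show "\<exists>l. l \<noteq> 0 \<and> compact (real_points_in_chart l (projected_veronese \<pi>))"
  proof -
    \<comment> \<open>The Hankel matrix (2 0 1; 0 1 0; 1 0 2) of this functional is positive
      definite.\<close>
    define l where "l = adjoint g (quartic 2 0 1 0 2)"
    have l: "l \<bullet> \<kappa> q = quartic 2 0 1 0 2 \<bullet> q" for q
      unfolding l_def using adjoint_works[OF lin(2)] by (simp add: inner_commute inv)
    have "l \<bullet> \<pi> (outer t t) > 0" if "t \<noteq> 0" for t
    proof -
      obtain s0 s1 s2 where s: "t = s0 *\<^sub>R k0 + s1 *\<^sub>R k1 + s2 *\<^sub>R k2" using comb by blast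
      then have nz: "\<not> (s0 = 0 \<and> s1 = 0 \<and> s2 = 0)" using that by auto
      have "l \<bullet> \<pi> (outer t t) = (s0 + s2)^2 + s0^2 + s1^2 + s2^2"
        unfolding s sq[symmetric] l
        by (simp add: inner_vec_def sum_5 qsq_def power2_eq_square algebra_simps)
      moreover have "s0^2 + s1^2 + s2^2 > 0"
        using nz by (simp add: sum_power2_gt_zero_iff add_pos_nonneg add_nonneg_pos order_less_le)
          (smt (verit) zero_le_power2 power_zero_numeral zero_eq_power2)
      ultimately show ?thesis by (smt (verit) zero_le_power2)
    qed
    then have "compact (real_points_in_chart l (projected_veronese \<pi>))"
      by (rule compact_of_definite)
    moreover have "l \<noteq> 0" using l[of "quartic 1 0 0 0 0"] by (auto simp: inner_vec_def sum_5)
    ultimately show ?thesis by blast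
  qed
  assume l: "l \<noteq> 0" and compact: "compact (real_points_in_chart l (projected_veronese \<pi>))"
  \<comment> \<open>Compactness gives definiteness of \<open>l\<close> only up to sign; \<epsilon>
    goes into both \<open>\<kappa>\<close> and \<open>g\<close> and cancels in
    \<open>normalize\<close>.\<close>
  have main: "hypersurface_of_degree 6 (algebraic_boundary l (projected_veronese \<pi>))"
    if \<epsilon>: "\<epsilon> = 1 \<or> \<epsilon> = - 1" and sgn: "\<And>t. t \<noteq> 0 \<Longrightarrow> \<epsilon> * (l \<bullet> \<pi> (outer t t)) > 0" for \<epsilon>
  proof -
    have \<epsilon>2: "\<epsilon> * \<epsilon> = 1" "\<epsilon> \<noteq> 0" using \<epsilon> by auto
    interpret positive_quartic_chart "\<lambda>q. \<epsilon> *\<^sub>R \<kappa> q" "\<lambda>y. \<epsilon> *\<^sub>R g y" l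
    proof (rule positive_quartic_chart.intro)
      show "linear (\<lambda>q. \<epsilon> *\<^sub>R \<kappa> q)" "linear (\<lambda>y. \<epsilon> *\<^sub>R g y)"
        using lin by (simp_all add: linear_compose_scale_right)
      show "\<epsilon> *\<^sub>R g (\<epsilon> *\<^sub>R \<kappa> q) = q" "\<epsilon> *\<^sub>R \<kappa> (\<epsilon> *\<^sub>R g y) = y" for q y
        by (simp_all add: linear_scale[OF lin(1)] linear_scale[OF lin(2)] inv \<epsilon>2)
      show "l \<bullet> (\<epsilon> *\<^sub>R \<kappa> (qsq s0 s1 s2)) > 0" if "\<not> (s0 = 0 \<and> s1 = 0 \<and> s2 = 0)" for s0 s1 s2
        using sgn[OF indep[OF that]] by (simp add: sq)
    qed
    have norm: "normalize q = inverse (l \<bullet> \<kappa> q) *\<^sub>R \<kappa> q" for q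
      using \<epsilon> by (auto simp: normalize_def)
    have "real_points_in_chart l (projected_veronese \<pi>) = squares"
    proof (intro set_eqI iffI)
      fix y assume "y \<in> real_points_in_chart l (projected_veronese \<pi>)"
      then obtain t where t: "l \<bullet> \<pi> (outer t t) \<noteq> 0" "y = inverse (l \<bullet> \<pi> (outer t t)) *\<^sub>R \<pi> (outer t t)"
        by (auto simp: real_points_in_chart_eq[OF proj rank])
      obtain s0 s1 s2 where s: "t = s0 *\<^sub>R k0 + s1 *\<^sub>R k1 + s2 *\<^sub>R k2" using comb by blast
      have "\<pi> (outer t t) = \<kappa> (qsq s0 s1 s2)" by (simp add: s sq)
      then have "\<not> (s0 = 0 \<and> s1 = 0 \<and> s2 = 0)" "y = normalize (qsq s0 s1 s2)"
        using t zero by (auto simp: norm)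
      then show "y \<in> squares" unfolding squares_def by blast
    next
      fix y assume "y \<in> squares"
      then obtain s0 s1 s2 where s: "\<not> (s0 = 0 \<and> s1 = 0 \<and> s2 = 0)" "y = normalize (qsq s0 s1 s2)"
        by (auto simp: squares_def)
      then show "y \<in> real_points_in_chart l (projected_veronese \<pi>)"
        using sgn[OF indep[OF s(1)]] unfolding real_points_in_chart_eq[OF proj rank] norm sq by force
    qed
    then show ?thesis
      using boundary_hypersurface compact by (simp add: algebraic_boundary_def conv_in_chart_def)
  qed
  from definite_sign[OF definite_of_compact[OF l compact]]
  show "hypersurface_of_degree 6 (algebraic_boundary l (projected_veronese \<pi>))"
    using main[of 1] main[of "- 1"] by auto
qed

end

end

text \<open>Scaled eigenvectors give A = v1 v1^T + v2 v2^T - v3 v3^T. The hyperbolic part factors as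
  v3^2 - v2^2 = (v2 + v3)(v3 - v2), and these two factors serve as k0 and k2.\<close>

lemma signature_21_normal_form:
  fixes A :: "real^3^3"
  assumes sym: "transpose A = A" and sig: "signature A = (2, 1)"
  obtains k0 k1 k2 where "2 *\<^sub>R A = 2 *\<^sub>R outer k1 k1 - (outer k0 k2 + outer k2 k0)"
    "span {k0, k1, k2} = UNIV"
proof -
  obtain P N \<mu> where P: "finite P" "finite N" "card P = 2" "card N = 1" "P \<inter> N = {}"
    "\<forall>v\<in>P. \<mu> v > (0::real)" "\<forall>v\<in>N. \<mu> v < 0" "span (P \<union> N) = UNIV"
    "A = (\<Sum>v\<in>P \<union> N. \<mu> v *\<^sub>R outer v v)"
    by (rule signature_decomposition[OF sym sig]) simp
  obtain p1 p2 where p: "P = {p1, p2}" "p1 \<noteq> p2" using P(3) by (auto simp: card_2_iff)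
  obtain n where n: "N = {n}" using P(4) by (auto simp: card_1_singleton_iff)
  have dist: "n \<noteq> p1" "n \<noteq> p2" using P(5) p n by auto
  have pos: "\<mu> p1 > 0" "\<mu> p2 > 0" "\<mu> n < 0" using P(6,7) p n by auto
  define v1 v2 v3 where v: "v1 = sqrt (\<mu> p1) *\<^sub>R p1" "v2 = sqrt (\<mu> p2) *\<^sub>R p2" "v3 = sqrt (- \<mu> n) *\<^sub>R n"
  have outer_scale: "outer (c *\<^sub>R v) (c *\<^sub>R v) = (c * c) *\<^sub>R outer v v" for c and v :: "real^3"
    by (simp add: vec_eq_iff)
  have "A = \<mu> p1 *\<^sub>R outer p1 p1 + \<mu> p2 *\<^sub>R outer p2 p2 + \<mu> n *\<^sub>R outer n n"
    unfolding P(9) p n using p(2) dist by (simp add: algebra_simps)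
  also have "\<dots> = outer v1 v1 + outer v2 v2 - outer v3 v3"
    using pos by (simp add: v outer_scale)
  finally have A: "A = outer v1 v1 + outer v2 v2 - outer v3 v3" .
  show thesis
  proof (rule that[of v1 "v2 + v3" "v3 - v2"])
    show "2 *\<^sub>R A = 2 *\<^sub>R outer v1 v1 - (outer (v2 + v3) (v3 - v2) + outer (v3 - v2) (v2 + v3))"
      unfolding A by (simp add: vec_eq_iff algebra_simps)
    let ?S = "span {v2 + v3, v1, v3 - v2}"
    have S: "v2 + v3 \<in> ?S" "v1 \<in> ?S" "v3 - v2 \<in> ?S" by (simp_all add: span_base)
    have "v3 = (1/2) *\<^sub>R ((v2 + v3) + (v3 - v2))" "v2 = (1/2) *\<^sub>R ((v2 + v3) - (v3 - v2))"
      by (simp_all flip: scaleR_2)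
    then have "v3 \<in> ?S" "v2 \<in> ?S" using S by (metis span_add span_diff span_scale)+
    then have "p1 \<in> ?S" "p2 \<in> ?S" "n \<in> ?S"
      using S(2) pos span_scale[of v1 "{v2 + v3, v1, v3 - v2}" "inverse (sqrt (\<mu> p1))"]
        span_scale[of v2 "{v2 + v3, v1, v3 - v2}" "inverse (sqrt (\<mu> p2))"]
        span_scale[of v3 "{v2 + v3, v1, v3 - v2}" "inverse (sqrt (- \<mu> n))"]
      by (simp_all add: v)
    then have "span (P \<union> N) \<subseteq> ?S" by (intro span_minimal) (auto simp: p n)
    then show "?S = UNIV" using P(8) by auto
  qed
qed

section \<open>Change of sign of the center, and the conclusion\<close>

lemma rank_uminus_3:
  fixes A :: "real^3^3"
  assumes "rank A = 3"
  shows "rank (- A) = 3"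
proof -
  have "(- A) *v x = - (A *v x)" for x
    by (simp add: vec_eq_iff matrix_vector_mult_def sum_negf)
  then have "(\<exists>x. x \<noteq> 0 \<and> (- A) *v x = 0) \<longleftrightarrow> (\<exists>x. x \<noteq> 0 \<and> A *v x = 0)" by simp
  then show ?thesis
    using assms unfolding matrix_nonfull_linear_equations_eq by simp
qed

lemma projection_from_uminus:
  assumes "projection_from A \<pi>"
  shows "projection_from (- A) \<pi>"
proof -
  have "span {- A} = span {A}"
  proof
    show "span {- A} \<subseteq> span {A}"
      by (rule span_minimal) (auto simp: span_base span_neg)
    have "- (- A) \<in> span {- A}" by (rule span_neg) (simp add: span_base)
    then show "span {A} \<subseteq> span {- A}"
      by (intro span_minimal) auto
  qed
  then show ?thesis using assms by (simp add: projection_from_def)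
qed

lemma transpose_uminus: "transpose A = A \<Longrightarrow> transpose (- A) = - (A :: real^'n^'n)"
  by (simp add: transpose_def vec_eq_iff)

theorem theorem2p1:
  fixes A :: "real^3^3" and \<pi> :: "real^3^3 \<Rightarrow> real^5"
  assumes "transpose A = A" and "rank A = 3" and "projection_from A \<pi>"
  shows "(signature A = (3, 0) \<or> signature (- A) = (3, 0) \<longrightarrow>
            (\<forall>l. l \<noteq> 0 \<longrightarrow> conv_in_chart l (projected_veronese \<pi>) = chart l)) \<and>
         (signature A = (2, 1) \<or> signature (- A) = (2, 1) \<longrightarrow>
            (\<exists>l. l \<noteq> 0 \<and> compact (real_points_in_chart l (projected_veronese \<pi>))) \<and>
            (\<forall>l. l \<noteq> 0 \<and> compact (real_points_in_chart l (projected_veronese \<pi>)) \<longrightarrow>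
                 hypersurface_of_degree 6 (algebraic_boundary l (projected_veronese \<pi>))))"
proof -
  have definite: "conv_in_chart l (projected_veronese \<pi>) = chart l"
    if B: "transpose B = B" "rank B = 3" "projection_from B \<pi>" "signature B = (3, 0)" and l: "l \<noteq> 0"
    for B l
  proof -
    obtain P N \<mu> where P: "finite P" "finite N" "card P = 3" "card N = 0" "P \<inter> N = {}"
      "\<forall>v\<in>P. \<mu> v > (0::real)" "\<forall>v\<in>N. \<mu> v < 0" "span (P \<union> N) = UNIV"
      "B = (\<Sum>v\<in>P \<union> N. \<mu> v *\<^sub>R outer v v)"
      by (rule signature_decomposition[OF B(1,4)]) simp
    then have "N = {}" by simp
    then show ?thesis
      using conv_of_definite_center[OF B(3,2), of \<mu> P l] P l by simp
  qed
  have indefinite: "(\<exists>l. l \<noteq> 0 \<and> compact (real_points_in_chart l (projected_veronese \<pi>))) \<and>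
      (\<forall>l. l \<noteq> 0 \<and> compact (real_points_in_chart l (projected_veronese \<pi>)) \<longrightarrow>
         hypersurface_of_degree 6 (algebraic_boundary l (projected_veronese \<pi>)))"
    if B: "transpose B = B" "rank B = 3" "projection_from B \<pi>" "signature B = (2, 1)" for B
  proof -
    obtain k0 k1 k2 where k: "2 *\<^sub>R B = 2 *\<^sub>R outer k1 k1 - (outer k0 k2 + outer k2 k0)"
      "span {k0, k1, k2} = UNIV"
      by (rule signature_21_normal_form[OF B(1,4)])
    show ?thesis using indefinite_center[OF B(3,2) k] by blast
  qed
  note neg = transpose_uminus[OF assms(1)] rank_uminus_3[OF assms(2)] projection_from_uminus[OF assms(3)]
  show ?thesis
    using definite[OF assms] definite[OF neg] indefinite[OF assms] indefinite[OF neg] by blast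
qed

end
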